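(* Let $N\in\mathbb{N}$, let $\beta_1,\dots,\beta_N>1$, and for each $1\le n\le N$ let $\Sigma_{A_n}\subset S_{\beta_n}$ be a subshift of finite type such that there is a finite word $i_1\dots i_{k_n}$ which occurs in $S_{\beta_n}$ but does not occur in $\Sigma_{A_n}$. Then the set \[ \bigcap_{n=1}^N G_{f_{\beta_n}}(\pi_{\beta_n}(\Sigma_{A_n})) \] has Hausdorff dimension $1$, where for $\beta>1$ and $\Sigma\subset S_\beta$, \[ G_{f_\beta}(\pi_\beta(\Sigma))=\Big\{\, y\in[0,1) : \pi_\beta(\Sigma)\cap\overline{\bigcup_{m=0}^\infty \{f_\beta^m(y)\}}=\emptyset \,\Big\}. \]
   Context: For $\beta>1$ let $f_\beta(x)=\beta x \pmod 1$ and, for $x\in[0,1]$, let $d(x,\beta)=(d(x,\beta)_n)_{n=0}^\infty$ with $d(x,\beta)_n=[\beta f_\beta^n(x)]$, where $[\cdot]$ is the integer part. The $\beta$-shift $S_\beta$ is the closure, in the product topology on sequences of non-negative integer digits, of $\{d(x,\beta): x\in[0,1)\}$. The map $\pi_\beta$ is given by $\pi_\beta((i_k)_{k=0}^\infty)=\sum_{k=0}^\infty i_k\beta^{-(k+1)}$. A finite word occurs in a set of sequences if it appears as a block of consecutive digits in some sequence of that set. A subshift of finite type is a set of all sequences over a finite alphabet avoiding a given finite collection of finite words. *)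

theory Defs
  imports "HOL-Analysis.Analysis"
begin

definition beta_map :: "real \<Rightarrow> real \<Rightarrow> real" where
  "beta_map \<beta> x = frac (\<beta> * x)"

text \<open>The integer part is non-negative for \<open>x \<ge> 0\<close>, so \<open>nat\<close> loses nothing there.\<close>

definition beta_digits :: "real \<Rightarrow> real \<Rightarrow> nat \<Rightarrow> nat" where
  "beta_digits \<beta> x n = nat \<lfloor>\<beta> * (beta_map \<beta> ^^ n) x\<rfloor>"

text \<open>The type \<open>nat \<Rightarrow> nat\<close> carries the product topology of the discrete
  topology on \<open>nat\<close>.\<close>

definition beta_shift :: "real \<Rightarrow> (nat \<Rightarrow> nat) set" where
  "beta_shift \<beta> = closure (beta_digits \<beta> ` {0..<1})"

definition beta_proj :: "real \<Rightarrow> (nat \<Rightarrow> nat) \<Rightarrow> real" where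
  "beta_proj \<beta> s = (\<Sum>k. real (s k) / \<beta> ^ (k + 1))"

definition word_occurs :: "'a list \<Rightarrow> (nat \<Rightarrow> 'a) set \<Rightarrow> bool" where
  "word_occurs w S \<longleftrightarrow> (\<exists>s\<in>S. \<exists>m. \<forall>j<length w. s (m + j) = w ! j)"

definition subshift_finite_type :: "(nat \<Rightarrow> 'a) set \<Rightarrow> bool" where
  "subshift_finite_type S \<longleftrightarrow>
     (\<exists>A F. finite A \<and> finite F \<and> S = {s. range s \<subseteq> A \<and> (\<forall>w\<in>F. \<not> word_occurs w {s})})"

definition orbit_avoiding :: "(real \<Rightarrow> real) \<Rightarrow> real set \<Rightarrow> real set" where
  "orbit_avoiding f E = {y \<in> {0..<1}. E \<inter> closure (\<Union>m. {(f ^^ m) y}) = {}}"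

text \<open>The contribution of a bounded covering set to the \<open>s\<close>-dimensional Hausdorff
  measure, with the conventions \<open>0 ^ 0 = 1\<close> for nonempty sets (whereas
  \<open>0 powr 0 = 0\<close>) and value \<open>0\<close> for the empty set.\<close>

definition diam_weight :: "real \<Rightarrow> 'a::metric_space set \<Rightarrow> ennreal" where
  "diam_weight s U =
     (if U = {} then 0 else if s = 0 then 1 else ennreal (diameter U powr s))"

text \<open>Boundedness is required explicitly because \<open>diameter\<close> is not meaningful
  on unbounded sets.\<close>

definition hausdorff_premeasure :: "real \<Rightarrow> real \<Rightarrow> 'a::metric_space set \<Rightarrow> ennreal" where
  "hausdorff_premeasure s \<delta> A =
     (INF U \<in> {U :: nat \<Rightarrow> 'a set. A \<subseteq> (\<Union>i. U i) \<and> (\<forall>i. bounded (U i) \<and> diameter (U i) \<le> \<delta>)}.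
        \<Sum>i. diam_weight s (U i))"

definition hausdorff_measure :: "real \<Rightarrow> 'a::metric_space set \<Rightarrow> ennreal" where
  "hausdorff_measure s A = (SUP \<delta>\<in>{0<..}. hausdorff_premeasure s \<delta> A)"

definition hausdorff_dim :: "'a::metric_space set \<Rightarrow> ereal" where
  "hausdorff_dim A = Inf {ereal s | s. 0 \<le> s \<and> hausdorff_measure s A = 0}"

end

theory Submission
  imports Defs "HOL-Real_Asymp.Real_Asymp"
begin

text \<open>A point \<open>y\<close> stays away from \<open>\<pi>\<^sub>\<beta>(\<Sigma>)\<close> as soon as a word \<open>w\<close> missing from \<open>\<Sigma>\<close> recurs in its
  expansion with bounded gaps, in a robust way: after every time \<open>m\<close> there is an occurrence of
  \<open>w\<close> that is shared by all points within distance \<open>\<rho> \<beta>\<^sup>-\<^sup>m\<close> of \<open>y\<close>. Indeed, if \<open>e = \<pi>\<^sub>\<beta>(s)\<close> with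
  \<open>s \<in> \<Sigma>\<close> were within \<open>\<rho>\<close> of \<open>f\<^sup>m(y)\<close>, then \<open>e\<close> would be the image \<open>f\<^sup>m(x)\<close> of such a
  nearby point \<open>x\<close>, and \<open>s\<close> would agree with the greedy digits of \<open>e\<close> far enough to contain \<open>w\<close>
  (lemma \<open>orbit_avoiding_if_word_recurs\<close>).

  Points for which this happens for all \<open>N\<close> maps at once are built as the branches of a tree of
  intervals. An interval of level \<open>k\<close> is divided into \<open>M\<close> equal pieces, and inside a piece one
  passes to a subinterval on which \<open>w\<^sub>n\<close> occurs for each \<open>n\<close> in turn. The cost of this passage
  is a fixed factor \<open>c\<close> provided that the piece still has a macroscopic image under an iterate of
  \<open>f\<^sub>n\<close> which is affine on it (lemma \<open>word_at_simultaneous\<close>): an image of length at least some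
  \<open>\<eta>\<close> contains a full branch of an iterate, whose order is bounded in terms of \<open>\<eta>\<close>.

  What has to be shown is that most pieces are like that. The iterate \<open>f\<^sup>g\<close> can fail to be affine
  on an interval only if one of its zeros lies in the interior, and an interval of length \<open>L\<close>
  contains at most \<open>C \<beta>\<^sup>g L + g + 1\<close> of them (lemma \<open>card_cut_points_le\<close>). If \<open>g\<close> is chosen such
  that \<open>f\<^sup>g\<close> stretches the pieces to length about \<open>\<epsilon>\<close>, this number is at most
  \<open>C \<epsilon> M + O(log M)\<close>. Hence, for \<open>\<epsilon>\<close> small depending on \<open>\<beta>\<close> and \<open>N\<close> only, and \<open>M\<close> large, at
  least half of the pieces are uncut for all \<open>N\<close> maps (lemma \<open>many_good_pieces\<close>).

  The tree therefore has at least \<open>M div 2\<close> children per interval, each of relative length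
  \<open>c / (3 M)\<close>, where \<open>c\<close> does not depend on \<open>M\<close>. Its set of branches has dimension at least
  \<open>log (M div 2) / log (3 M / c)\<close>, which tends to \<open>1\<close> as \<open>M\<close> grows. The lower bound on Hausdorff
  measure comes from coding the branches by real numbers: the map from branches to codes is
  Hoelder continuous of a given exponent \<open>s < 1\<close> if \<open>M\<close> is large, so that a cover of the branches by
  small sets would yield a cover of the unit interval of small total length (lemmas \<open>hausdorff_measure_nonzero\<close> and
  \<open>hausdorff_measure_tree_nonzero\<close>).\<close>

section \<open>Iterates of the \<open>\<beta>\<close>-transformation on intervals without cut points\<close>

lemma beta_map_range: "beta_map \<beta> x \<in> {0..<1}"
  by (simp add: beta_map_def frac_lt_1)

lemma beta_iterate_range: "x \<in> {0..<1} \<Longrightarrow> (beta_map \<beta> ^^ n) x \<in> {0..<1}"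
  by (cases n) (use beta_map_range in auto)

lemma beta_iterate_zero_mono:
  assumes "(beta_map \<beta> ^^ m) x = 0" "m \<le> n"
  shows "(beta_map \<beta> ^^ n) x = 0"
proof -
  have "(beta_map \<beta> ^^ (k + m)) x = 0" for k
  proof (induction k)
    case (Suc k)
    then show ?case by (simp add: beta_map_def[of _ 0])
  qed (use assms in simp)
  then show ?thesis using assms(2) by (metis le_add_diff_inverse2)
qed

lemma beta_iterate_add: "(beta_map \<beta> ^^ (m + n)) x = (beta_map \<beta> ^^ n) ((beta_map \<beta> ^^ m) x)"
  by (metis add.commute comp_apply funpow_add)

lemma beta_digits_add: "beta_digits \<beta> x (m + i) = beta_digits \<beta> ((beta_map \<beta> ^^ m) x) i"
  by (simp add: beta_digits_def beta_iterate_add)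

lemma beta_iterate_Suc:
  assumes "\<beta> > 0" "x \<in> {0..<1}"
  shows "(beta_map \<beta> ^^ Suc n) x = \<beta> * (beta_map \<beta> ^^ n) x - beta_digits \<beta> x n"
  using beta_iterate_range[OF assms(2), where \<beta> = \<beta> and n = n] assms(1)
  by (simp add: beta_map_def beta_digits_def frac_def)

lemma beta_digits_sum:
  assumes "\<beta> > 0" "x \<in> {0..<1}"
  shows "(\<Sum>k<n. real (beta_digits \<beta> x k) / \<beta> ^ (k + 1)) = x - (beta_map \<beta> ^^ n) x / \<beta> ^ n"
proof (induction n)
  case (Suc n)
  have "(beta_map \<beta> ^^ Suc n) x / \<beta> ^ Suc n
      = (beta_map \<beta> ^^ n) x / \<beta> ^ n - real (beta_digits \<beta> x n) / \<beta> ^ Suc n"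
    unfolding beta_iterate_Suc[OF assms] using assms(1) by (simp add: diff_divide_distrib)
  then show ?case using Suc.IH by simp
qed simp

lemma digits_eq_imp_close:
  assumes "\<beta> > 0" "x \<in> {0..<1}" "x' \<in> {0..<1}" "\<And>i. i < k \<Longrightarrow> beta_digits \<beta> x i = beta_digits \<beta> x' i"
  shows "\<bar>x - x'\<bar> \<le> 1 / \<beta> ^ k"
proof -
  let ?f = "\<lambda>x. (beta_map \<beta> ^^ k) x"
  have "x - ?f x / \<beta> ^ k = (\<Sum>i<k. real (beta_digits \<beta> x i) / \<beta> ^ (i + 1))"
    using beta_digits_sum[OF assms(1,2), of k] by simp
  also have "\<dots> = (\<Sum>i<k. real (beta_digits \<beta> x' i) / \<beta> ^ (i + 1))"
    using assms(4) by (intro sum.cong) auto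
  also have "\<dots> = x' - ?f x' / \<beta> ^ k"
    by (rule beta_digits_sum[OF assms(1,3)])
  finally have "x - x' = (?f x - ?f x') / \<beta> ^ k" by (simp add: diff_divide_distrib)
  moreover have "\<bar>?f x - ?f x'\<bar> \<le> 1"
    using beta_iterate_range[OF assms(2), of k \<beta>] beta_iterate_range[OF assms(3), of k \<beta>] by auto
  ultimately show ?thesis using assms(1) by (simp add: divide_right_mono)
qed

text \<open>Since \<open>0\<close> is a fixed point, the zeros of the \<open>g\<close>-th iterate in the interior are exactly the points
  at which one of the first \<open>g\<close> iterates jumps. For \<open>0 \<le> a < b \<le> 1\<close> this says that the
  half-open interval \<open>[a, b)\<close> lies in a single cylinder of order \<open>g\<close>.\<close>

definition uncut :: "real \<Rightarrow> nat \<Rightarrow> real \<Rightarrow> real \<Rightarrow> bool" where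
  "uncut \<beta> g a b \<longleftrightarrow> (\<forall>x\<in>{a<..<b}. (beta_map \<beta> ^^ g) x \<noteq> 0)"

lemma uncut_mono:
  assumes "uncut \<beta> n a b" "m \<le> n" "a \<le> a'" "b' \<le> b"
  shows "uncut \<beta> m a' b'"
  using assms beta_iterate_zero_mono[of m \<beta> _ n] unfolding uncut_def by force

text \<open>The \<open>g\<close>-th iterate cannot change branch on an uncut interval: by induction the previous iterate is
  affine and increasing there, so a new value of the next digit would be announced by a point at which
  \<open>\<beta> f\<^sup>g\<close> is an integer, that is, by a zero of \<open>f\<^sup>g\<^sup>+\<^sup>1\<close>.\<close>

lemma uncut_imp_affine:
  assumes "\<beta> > 0" "uncut \<beta> g a b" "x \<in> {a..<b}"
  shows "(beta_map \<beta> ^^ g) x = (beta_map \<beta> ^^ g) a + \<beta> ^ g * (x - a)"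
    and "k < g \<Longrightarrow> beta_digits \<beta> x k = beta_digits \<beta> a k"
proof -
  have "(beta_map \<beta> ^^ g) x = (beta_map \<beta> ^^ g) a + \<beta> ^ g * (x - a) \<and>
        (\<forall>k<g. beta_digits \<beta> x k = beta_digits \<beta> a k)"
    if "x \<in> {a..<b}" for x
    using assms(2) that
  proof (induction g arbitrary: x)
    case (Suc g)
    let ?f = "beta_map \<beta>"
    have un: "uncut \<beta> g a b" using uncut_mono[OF Suc.prems(1), of g] by simp
    note IH = Suc.IH[OF un]
    have a: "a \<in> {a..<b}" using Suc.prems by auto
    have eq: "\<lfloor>\<beta> * (?f ^^ g) x\<rfloor> = \<lfloor>\<beta> * (?f ^^ g) a\<rfloor>"
    proof (rule ccontr)
      assume ne: "\<not> ?thesis"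
      \<comment> \<open>the point at which the affine function \<open>\<beta> f\<^sup>g\<close> reaches the integer part of its value at \<open>x\<close>\<close>
      define y where "y = a + (of_int \<lfloor>\<beta> * (?f ^^ g) x\<rfloor> - \<beta> * (?f ^^ g) a) / \<beta> ^ Suc g"
      have ge: "\<beta> * (?f ^^ g) a \<le> \<beta> * (?f ^^ g) x"
        using IH[OF Suc.prems(2)] Suc.prems(2) assms(1) by simp
      then have "\<lfloor>\<beta> * (?f ^^ g) a\<rfloor> < \<lfloor>\<beta> * (?f ^^ g) x\<rfloor>"
        using ne floor_mono[OF ge] by linarith
      then have lt: "\<beta> * (?f ^^ g) a < of_int \<lfloor>\<beta> * (?f ^^ g) x\<rfloor>"
        by (simp add: floor_less_iff)
      have "of_int \<lfloor>\<beta> * (?f ^^ g) x\<rfloor> - \<beta> * (?f ^^ g) a \<le> \<beta> * (?f ^^ g) x - \<beta> * (?f ^^ g) a"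
        by simp
      also have "\<dots> = \<beta> ^ Suc g * (x - a)"
        unfolding conjunct1[OF IH[OF Suc.prems(2)]] by (simp add: algebra_simps)
      finally have "(of_int \<lfloor>\<beta> * (?f ^^ g) x\<rfloor> - \<beta> * (?f ^^ g) a) / \<beta> ^ Suc g \<le> x - a"
        using assms(1) by (simp add: divide_le_eq mult.commute mult.left_commute)
      then have yx: "y \<le> x" unfolding y_def by simp
      have ya: "y > a" using lt assms(1) unfolding y_def by simp
      have yab: "y \<in> {a<..<b}" using yx ya Suc.prems by auto
      have "\<beta> ^ Suc g * (y - a) = of_int \<lfloor>\<beta> * (?f ^^ g) x\<rfloor> - \<beta> * (?f ^^ g) a"
        using assms(1) unfolding y_def by simp
      moreover have "\<beta> * (?f ^^ g) y = \<beta> * (?f ^^ g) a + \<beta> ^ Suc g * (y - a)"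
        using conjunct1[OF IH[of y]] yab by (simp add: distrib_left mult.assoc)
      ultimately have "\<beta> * (?f ^^ g) y = of_int \<lfloor>\<beta> * (?f ^^ g) x\<rfloor>" by simp
      then have "(?f ^^ Suc g) y = 0" by (simp add: beta_map_def)
      then show False using Suc.prems(1) yab unfolding uncut_def by blast
    qed
    have step: "(?f ^^ Suc g) z = \<beta> * (?f ^^ g) z - of_int \<lfloor>\<beta> * (?f ^^ g) z\<rfloor>" for z
      by (simp add: beta_map_def[of \<beta> "(?f ^^ g) z"] frac_def)
    have "\<beta> * (?f ^^ g) x = \<beta> * (?f ^^ g) a + \<beta> ^ Suc g * (x - a)"
      using conjunct1[OF IH[OF Suc.prems(2)]] by (simp add: distrib_left mult.assoc)
    then have "(?f ^^ Suc g) x = (?f ^^ Suc g) a + \<beta> ^ Suc g * (x - a)"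
      unfolding step eq by simp
    moreover have "beta_digits \<beta> x k = beta_digits \<beta> a k" if "k < Suc g" for k
      using that eq IH[OF Suc.prems(2)] by (auto simp: beta_digits_def less_Suc_eq)
    ultimately show ?case by blast
  qed auto
  from this[OF assms(3)] show "(beta_map \<beta> ^^ g) x = (beta_map \<beta> ^^ g) a + \<beta> ^ g * (x - a)"
    and "k < g \<Longrightarrow> beta_digits \<beta> x k = beta_digits \<beta> a k" by auto
qed

text \<open>The affine image of \<open>[a, b)\<close> has to fit into the unit interval.\<close>

lemma uncut_imp_short:
  assumes "\<beta> > 0" "uncut \<beta> g a b" "0 \<le> a" "a < b" "b \<le> 1"
  shows "(beta_map \<beta> ^^ g) a + \<beta> ^ g * (b - a) \<le> 1"
proof (rule ccontr)
  let ?fa = "(beta_map \<beta> ^^ g) a"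
  assume "\<not> ?thesis"
  then have gt: "1 < ?fa + \<beta> ^ g * (b - a)" by simp
  define x where "x = a + (1 - ?fa) / \<beta> ^ g"
  have "?fa \<in> {0..<1}" using beta_iterate_range[of a] assms by auto
  moreover have "(1 - ?fa) / \<beta> ^ g < b - a"
    using gt assms(1) by (subst pos_divide_less_eq) (auto simp: algebra_simps)
  ultimately have x: "x \<in> {a..<b}" using assms(1) unfolding x_def by auto
  have "\<beta> ^ g * (x - a) = 1 - ?fa" using assms(1) unfolding x_def by simp
  then have "(beta_map \<beta> ^^ g) x = 1" using uncut_imp_affine(1)[OF assms(1,2) x] by simp
  moreover have "(beta_map \<beta> ^^ g) x \<in> {0..<1}" using beta_iterate_range[of x] x assms by auto
  ultimately show False by simp
qed

text \<open>The affine branch of \<open>f\<^sup>m\<close> on an uncut interval can be inverted on any interval in its image, which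
  turns statements about intervals of macroscopic size into statements at arbitrarily small scales.\<close>

lemma uncut_pullback:
  assumes "\<beta> > 0" "uncut \<beta> m a b" "a < b" "uncut \<beta> n u v"
    "(beta_map \<beta> ^^ m) a \<le> u" "u < v" "v \<le> (beta_map \<beta> ^^ m) a + \<beta> ^ m * (b - a)"
  obtains a' b' where "a \<le> a'" "a' < b'" "b' \<le> b" "b' - a' = (v - u) / \<beta> ^ m"
    "(beta_map \<beta> ^^ m) a' = u" "uncut \<beta> (m + n) a' b'"
proof
  let ?fa = "(beta_map \<beta> ^^ m) a"
  define a' where "a' = a + (u - ?fa) / \<beta> ^ m"
  define b' where "b' = a + (v - ?fa) / \<beta> ^ m"
  have "(v - ?fa) / \<beta> ^ m \<le> b - a"
    using assms(1,7) by (subst pos_divide_le_eq) (auto simp: algebra_simps)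
  then show b: "b' \<le> b" unfolding b'_def by simp
  show a: "a \<le> a'" using assms(1,5) unfolding a'_def by simp
  show ab: "a' < b'" using assms(1,6) unfolding a'_def b'_def by (simp add: divide_strict_right_mono)
  show "b' - a' = (v - u) / \<beta> ^ m" unfolding a'_def b'_def by (simp add: diff_divide_distrib)
  have ua: "\<beta> ^ m * (a' - a) = u - ?fa" using assms(1) unfolding a'_def by simp
  have vb: "\<beta> ^ m * (b' - a) = v - ?fa" using assms(1) unfolding b'_def by simp
  show "(beta_map \<beta> ^^ m) a' = u"
    using uncut_imp_affine(1)[OF assms(1,2), of a'] a ab b ua by simp
  show "uncut \<beta> (m + n) a' b'" unfolding uncut_def
  proof
    fix x assume x: "x \<in> {a'<..<b'}"
    have "(beta_map \<beta> ^^ m) x = ?fa + \<beta> ^ m * (x - a)"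
      using uncut_imp_affine(1)[OF assms(1,2), of x] a ab b x by simp
    moreover have "\<beta> ^ m * (a' - a) < \<beta> ^ m * (x - a)" "\<beta> ^ m * (x - a) < \<beta> ^ m * (b' - a)"
      using x assms(1) by auto
    ultimately have "(beta_map \<beta> ^^ m) x \<in> {u<..<v}" using ua vb by auto
    then show "(beta_map \<beta> ^^ (m + n)) x \<noteq> 0"
      using assms(4) unfolding uncut_def beta_iterate_add by blast
  qed
qed

section \<open>Counting the cut points of an iterate\<close>

definition cut_points :: "real \<Rightarrow> nat \<Rightarrow> real \<Rightarrow> real \<Rightarrow> real set" where
  "cut_points \<beta> g a b = {x \<in> {a..<b}. (beta_map \<beta> ^^ g) x = 0}"

definition geom_sum :: "real \<Rightarrow> nat \<Rightarrow> real" where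
  "geom_sum \<beta> g = (\<Sum>i<g. \<beta> ^ Suc i)"

lemma geom_sum_Suc: "geom_sum \<beta> (Suc g) = \<beta> * geom_sum \<beta> g + \<beta>"
  unfolding geom_sum_def by (subst sum.lessThan_Suc_shift) (simp add: sum_distrib_left)

lemma geom_sum_le: "\<beta> > 1 \<Longrightarrow> geom_sum \<beta> g \<le> \<beta> / (\<beta> - 1) * \<beta> ^ g"
proof -
  assume \<beta>: "\<beta> > 1"
  have "geom_sum \<beta> g = \<beta> / (\<beta> - 1) * (\<beta> ^ g - 1)"
    by (induction g) (use \<beta> in \<open>auto simp: geom_sum_Suc geom_sum_def[of _ 0] field_simps\<close>)
  also have "\<dots> \<le> \<beta> / (\<beta> - 1) * \<beta> ^ g" using \<beta> by (intro mult_left_mono) auto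
  finally show ?thesis .
qed

text \<open>The map \<open>f\<close> sends each of its branches \<open>[i/\<beta>, (i+1)/\<beta>)\<close> affinely into the unit interval, so the zeros of
  \<open>f\<^sup>g\<^sup>+\<^sup>1\<close> are the preimages of the zeros of \<open>f\<^sup>g\<close>, branch by branch. This reduces counting for
  \<open>g + 1\<close> to counting for \<open>g\<close>.\<close>

lemma cut_points_Suc_subset:
  assumes "\<beta> > 1" "0 \<le> a" "a \<le> b"
  shows "cut_points \<beta> (Suc g) a b \<subseteq>
    (\<Union>i\<in>{\<lfloor>\<beta> * a\<rfloor>..\<lfloor>\<beta> * b\<rfloor>}. (\<lambda>z. (of_int i + z) / \<beta>) `
       cut_points \<beta> g (max 0 (\<beta> * a - of_int i)) (min 1 (\<beta> * b - of_int i)))"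
proof
  fix x assume x: "x \<in> cut_points \<beta> (Suc g) a b"
  define i where "i = \<lfloor>\<beta> * x\<rfloor>"
  define z where "z = beta_map \<beta> x"
  have xab: "\<beta> * a \<le> \<beta> * x" "\<beta> * x < \<beta> * b" using x assms(1) by (auto simp: cut_points_def)
  have xz: "\<beta> * x = of_int i + z" unfolding i_def z_def beta_map_def frac_def by simp
  have "x = (of_int i + z) / \<beta>" using xz assms(1) by (simp add: field_simps)
  moreover have "z \<in> {0..<1}" unfolding z_def by (rule beta_map_range)
  then have "z \<in> cut_points \<beta> g (max 0 (\<beta> * a - of_int i)) (min 1 (\<beta> * b - of_int i))"
    using x xab xz unfolding cut_points_def z_def by (auto simp: funpow_Suc_right simp del: funpow.simps)
  moreover have "i \<in> {\<lfloor>\<beta> * a\<rfloor>..\<lfloor>\<beta> * b\<rfloor>}"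
    using xab unfolding i_def by (auto intro: floor_mono)
  ultimately show "x \<in> (\<Union>i\<in>{\<lfloor>\<beta> * a\<rfloor>..\<lfloor>\<beta> * b\<rfloor>}. (\<lambda>z. (of_int i + z) / \<beta>) `
       cut_points \<beta> g (max 0 (\<beta> * a - of_int i)) (min 1 (\<beta> * b - of_int i)))" by blast
qed

lemma finite_cut_points:
  assumes "\<beta> > 1" "0 \<le> a" "b \<le> 1"
  shows "finite (cut_points \<beta> g a b)"
  using assms(2,3)
proof (induction g arbitrary: a b)
  case 0
  have "cut_points \<beta> 0 a b \<subseteq> {0}" by (auto simp: cut_points_def)
  then show ?case using finite_subset by blast
next
  case (Suc g)
  show ?case
  proof (cases "a \<le> b")
    case True
    show ?thesis
      by (rule finite_subset[OF cut_points_Suc_subset[OF assms(1) Suc.prems(1) True]])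
        (intro finite_UN_I finite_imageI Suc.IH; simp)
  qed (auto simp: cut_points_def)
qed

lemma card_cut_points_Suc:
  assumes "\<beta> > 1" "0 \<le> a" "a \<le> b" "b \<le> 1"
  shows "card (cut_points \<beta> (Suc g) a b) \<le> (\<Sum>i\<in>{\<lfloor>\<beta> * a\<rfloor>..\<lfloor>\<beta> * b\<rfloor>}.
       card (cut_points \<beta> g (max 0 (\<beta> * a - of_int i)) (min 1 (\<beta> * b - of_int i))))"
proof -
  let ?C = "\<lambda>i. cut_points \<beta> g (max 0 (\<beta> * a - of_int i)) (min 1 (\<beta> * b - of_int i))"
  have fin: "finite (?C i)" for i by (rule finite_cut_points) (use assms in auto)
  have "card (cut_points \<beta> (Suc g) a b) \<le>
      card (\<Union>i\<in>{\<lfloor>\<beta> * a\<rfloor>..\<lfloor>\<beta> * b\<rfloor>}. (\<lambda>z. (of_int i + z) / \<beta>) ` ?C i)"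
    by (rule card_mono[OF _ cut_points_Suc_subset]) (use assms fin in auto)
  also have "\<dots> \<le> (\<Sum>i\<in>{\<lfloor>\<beta> * a\<rfloor>..\<lfloor>\<beta> * b\<rfloor>}. card ((\<lambda>z. (of_int i + z) / \<beta>) ` ?C i))"
    by (rule card_UN_le) simp
  also have "\<dots> \<le> (\<Sum>i\<in>{\<lfloor>\<beta> * a\<rfloor>..\<lfloor>\<beta> * b\<rfloor>}. card (?C i))"
    by (intro sum_mono card_image_le fin)
  finally show ?thesis .
qed

text \<open>For an interval starting at \<open>0\<close> all branches are full except the last one, whose image
  starts again at \<open>0\<close>. The induction closes without an error that grows with \<open>g\<close>.\<close>

lemma card_cut_points_le_initial:
  assumes "\<beta> > 1" "0 \<le> c" "c \<le> 1"
  shows "real (card (cut_points \<beta> g 0 c)) \<le> c * geom_sum \<beta> g + 1"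
  using assms(2,3)
proof (induction g arbitrary: c)
  case 0
  have "cut_points \<beta> 0 0 c \<subseteq> {0}" by (auto simp: cut_points_def)
  then have "card (cut_points \<beta> 0 0 c) \<le> card {0::real}" by (intro card_mono) auto
  then show ?case by (simp add: geom_sum_def)
next
  case (Suc g)
  let ?k = "\<lfloor>\<beta> * c\<rfloor>"
  let ?C = "\<lambda>i. card (cut_points \<beta> g (max 0 (\<beta> * 0 - of_int i)) (min 1 (\<beta> * c - of_int i)))"
  have k0: "0 \<le> ?k" using assms Suc.prems by simp
  have "real (card (cut_points \<beta> (Suc g) 0 c)) \<le> real (\<Sum>i\<in>{\<lfloor>\<beta> * 0\<rfloor>..?k}. ?C i)"
    using card_cut_points_Suc[OF assms(1), of 0 c g] Suc.prems by (intro of_nat_mono) auto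
  also have "{\<lfloor>\<beta> * 0\<rfloor>..?k} = insert ?k {0..<?k}" using k0 by auto
  also have "real (\<Sum>i\<in>insert ?k {0..<?k}. ?C i) = real (?C ?k) + (\<Sum>i\<in>{0..<?k}. real (?C i))"
    by simp
  also have "real (?C ?k) \<le> (\<beta> * c - ?k) * geom_sum \<beta> g + 1"
  proof -
    have "\<beta> * c - ?k \<le> 1" by linarith
    moreover have "0 \<le> \<beta> * c - ?k" by simp
    moreover have "max 0 (\<beta> * 0 - ?k) = 0" using k0 by simp
    ultimately show ?thesis using Suc.IH[of "\<beta> * c - ?k"] by (simp only: min_absorb2)
  qed
  also have "(\<Sum>i\<in>{0..<?k}. real (?C i)) \<le> (\<Sum>i\<in>{0..<?k}. geom_sum \<beta> g + 1)"
  proof (rule sum_mono)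
    fix i assume i: "i \<in> {0..<?k}"
    then have "of_int i + 1 \<le> \<beta> * c" by auto linarith
    moreover have "max 0 (\<beta> * 0 - i) = 0" using i by simp
    ultimately show "real (?C i) \<le> geom_sum \<beta> g + 1" using Suc.IH[of 1] by (simp add: min_def)
  qed
  also have "(\<Sum>i\<in>{0..<?k}. geom_sum \<beta> g + 1) = ?k * (geom_sum \<beta> g + 1)" using k0 by simp
  also have "(\<beta> * c - ?k) * geom_sum \<beta> g + 1 + ?k * (geom_sum \<beta> g + 1) = \<beta> * c * geom_sum \<beta> g + ?k + 1"
    by (simp add: algebra_simps)
  also have "\<dots> \<le> \<beta> * c * geom_sum \<beta> g + \<beta> * c + 1" by simp
  also have "\<dots> = c * geom_sum \<beta> (Suc g) + 1" by (simp add: geom_sum_Suc algebra_simps)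
  finally show ?case by simp
qed

text \<open>In a general interval the first branch met is cut off on the left. Its image is again a general
  interval, and each such step costs one more point. This is the source of the linear term \<open>g\<close>, which
  is harmless against the exponential main term.\<close>

lemma card_cut_points_le:
  assumes "\<beta> > 1" "0 \<le> a" "a \<le> b" "b \<le> 1"
  shows "real (card (cut_points \<beta> g a b)) \<le> (b - a) * geom_sum \<beta> g + real g + 1"
  using assms(2-4)
proof (induction g arbitrary: a b)
  case 0
  have "cut_points \<beta> 0 a b \<subseteq> {0}" by (auto simp: cut_points_def)
  then have "card (cut_points \<beta> 0 a b) \<le> card {0::real}" by (intro card_mono) auto
  then show ?case by (simp add: geom_sum_def)
next
  case (Suc g)
  let ?j = "\<lfloor>\<beta> * a\<rfloor>"
  let ?k = "\<lfloor>\<beta> * b\<rfloor>"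
  let ?C = "\<lambda>i. card (cut_points \<beta> g (max 0 (\<beta> * a - of_int i)) (min 1 (\<beta> * b - of_int i)))"
  have ab: "\<beta> * a \<le> \<beta> * b" using assms(1) Suc.prems by simp
  have jk: "?j \<le> ?k" using ab by (rule floor_mono)
  have j: "0 \<le> \<beta> * a - ?j" "\<beta> * a - ?j \<le> 1" by (simp, linarith)
  have k: "0 \<le> \<beta> * b - ?k" "\<beta> * b - ?k \<le> 1" by (simp, linarith)
  have 1: "real (card (cut_points \<beta> (Suc g) a b)) \<le> real (\<Sum>i\<in>{?j..?k}. ?C i)"
    using card_cut_points_Suc[OF assms(1) Suc.prems, of g] by (rule of_nat_mono)
  show ?case
  proof (cases "?j = ?k")
    case True
    have "real (?C ?j) \<le> (\<beta> * b - ?j - (\<beta> * a - ?j)) * geom_sum \<beta> g + real g + 1"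
      using Suc.IH[of "\<beta> * a - ?j" "\<beta> * b - ?j"] j k ab True by (simp add: max_def min_def)
    also have "\<dots> \<le> (b - a) * geom_sum \<beta> (Suc g) + real (Suc g) + 1"
      using ab unfolding geom_sum_Suc by (simp add: algebra_simps)
    finally show ?thesis using 1 True by simp
  next
    case False
    then have jk: "?j < ?k" using jk by simp
    have split: "{?j..?k} = insert ?j (insert ?k {?j<..<?k})" using jk by auto
    have "real (\<Sum>i\<in>{?j..?k}. ?C i) = real (?C ?j) + real (?C ?k) + (\<Sum>i\<in>{?j<..<?k}. real (?C i))"
      unfolding split using jk by simp
    also have "real (?C ?j) \<le> (1 - (\<beta> * a - ?j)) * geom_sum \<beta> g + real g + 1"
    proof -
      have "1 \<le> \<beta> * b - ?j" using jk by linarith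
      then show ?thesis using Suc.IH[of "\<beta> * a - ?j" 1] j by (simp add: max_def min_def)
    qed
    also have "real (?C ?k) \<le> (\<beta> * b - ?k) * geom_sum \<beta> g + 1"
    proof -
      have "max 0 (\<beta> * a - ?k) = 0" using jk by linarith
      then show ?thesis
        using card_cut_points_le_initial[OF assms(1) k, of g] k by (simp only: min_absorb2)
    qed
    also have "(\<Sum>i\<in>{?j<..<?k}. real (?C i)) \<le> (\<Sum>i\<in>{?j<..<?k}. geom_sum \<beta> g + 1)"
    proof (rule sum_mono)
      fix i assume i: "i \<in> {?j<..<?k}"
      then have "of_int i + 1 \<le> \<beta> * b" "\<beta> * a \<le> of_int i" by (auto; linarith)+
      then show "real (?C i) \<le> geom_sum \<beta> g + 1"
        using card_cut_points_le_initial[OF assms(1), of 1 g] i by (simp add: max_def min_def)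
    qed
    also have "(\<Sum>i\<in>{?j<..<?k}. geom_sum \<beta> g + 1) = (of_int ?k - of_int ?j - 1) * (geom_sum \<beta> g + 1)"
      using jk by simp
    also have "(1 - (\<beta> * a - ?j)) * geom_sum \<beta> g + real g + 1 + ((\<beta> * b - ?k) * geom_sum \<beta> g + 1)
        + (of_int ?k - of_int ?j - 1) * (geom_sum \<beta> g + 1)
      = (\<beta> * b - \<beta> * a) * geom_sum \<beta> g + real g + 1 + (of_int ?k - of_int ?j)" by (simp add: algebra_simps)
    also have "\<dots> \<le> (\<beta> * b - \<beta> * a) * geom_sum \<beta> g + real g + 1 + (\<beta> * b - \<beta> * a + 1)"
      by linarith
    also have "\<dots> = (b - a) * geom_sum \<beta> (Suc g) + real (Suc g) + 1"
      by (simp add: geom_sum_Suc algebra_simps)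
    finally show ?thesis using 1 by simp
  qed
qed

section \<open>Prescribing a word inside a given interval\<close>

text \<open>Expansion: an interval that is never cut would be stretched beyond length \<open>1\<close>.\<close>

lemma exists_cut_point:
  assumes "\<beta> > 1" "0 \<le> a" "a < b" "b \<le> 1"
  obtains g x where "a < x" "x < b" "(beta_map \<beta> ^^ g) x = 0"
proof -
  have "\<exists>g. \<not> uncut \<beta> g a b"
  proof (rule ccontr)
    assume "\<not> ?thesis"
    then have "uncut \<beta> g a b" for g by blast
    then have le: "\<beta> ^ g * (b - a) \<le> 1" for g
      using uncut_imp_short[of \<beta> g a b] beta_iterate_range[of a g \<beta>] assms by fastforce
    obtain g where "1 / (b - a) < \<beta> ^ g" using real_arch_pow[OF assms(1)] by blast
    then show False using le[of g] assms by (simp add: divide_less_eq)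
  qed
  then show thesis using that unfolding uncut_def by auto
qed

lemma exists_uncut_right:
  assumes "\<beta> > 1" "0 \<le> x" "x < b" "b \<le> 1"
  obtains h where "h > 0" "x + h \<le> b" "uncut \<beta> g x (x + h)"
proof -
  let ?Z = "insert b (cut_points \<beta> g x b - {x})"
  have fin: "finite ?Z" using finite_cut_points[of \<beta> x b g] assms by auto
  define h where "h = Min ?Z - x"
  have "Min ?Z \<in> ?Z" using fin by (intro Min_in) auto
  then have "h > 0" using assms(3) unfolding h_def cut_points_def by auto
  moreover have "x + h \<le> b" unfolding h_def using fin by simp
  moreover have "uncut \<beta> g x (x + h)" unfolding uncut_def
  proof
    fix y assume y: "y \<in> {x<..<x + h}"
    show "(beta_map \<beta> ^^ g) y \<noteq> 0"
    proof
      assume "(beta_map \<beta> ^^ g) y = 0"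
      then have "y \<in> ?Z" using y \<open>x + h \<le> b\<close> by (auto simp: cut_points_def)
      then have "Min ?Z \<le> y" using fin by (intro Min_le) auto
      then show False using y unfolding h_def by simp
    qed
  qed
  ultimately show thesis by (rule that)
qed

text \<open>To the right of a zero of \<open>f\<^sup>g\<close> the orbit restarts from \<open>0\<close>, and intervals starting at \<open>0\<close> expand
  without being cut until they fill the unit interval.\<close>

lemma full_branch:
  assumes "\<beta> > 1" "0 \<le> a" "a < b" "b \<le> 1"
  obtains t x where "a \<le> x" "x + 1 / \<beta> ^ t \<le> b" "(beta_map \<beta> ^^ t) x = 0"
    "uncut \<beta> t x (x + 1 / \<beta> ^ t)"
proof -
  obtain g x where x: "a < x" "x < b" "(beta_map \<beta> ^^ g) x = 0"
    using exists_cut_point[OF assms] .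
  obtain h where h: "h > 0" "x + h \<le> b" "uncut \<beta> g x (x + h)"
    using exists_uncut_right[of \<beta> x b g] x assms by auto
  obtain t0 where t0: "1 / h < \<beta> ^ t0" using real_arch_pow[OF assms(1)] by blast
  have expand: "(beta_map \<beta> ^^ n) y = \<beta> ^ n * y" if "0 \<le> y" "\<beta> ^ n * y < 1" for n y
    using that
  proof (induction n)
    case (Suc n)
    have "\<beta> ^ n * y \<le> \<beta> ^ Suc n * y"
      using Suc.prems assms(1) by (intro mult_right_mono power_increasing) auto
    then have "(beta_map \<beta> ^^ n) y = \<beta> ^ n * y" using Suc by linarith
    moreover have "frac (\<beta> ^ Suc n * y) = \<beta> ^ Suc n * y"
      using Suc.prems assms(1) by (subst frac_eq) auto
    ultimately show ?case by (simp add: beta_map_def[of \<beta> "_ * _"] mult.assoc)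
  qed simp
  have th: "1 / \<beta> ^ (g + t0) < h"
  proof -
    have "\<beta> ^ t0 \<le> \<beta> ^ (g + t0)" using assms(1) by (intro power_increasing) auto
    then have "1 / h < \<beta> ^ (g + t0)" using t0 by linarith
    then show ?thesis using h(1) assms(1) by (simp add: field_simps)
  qed
  have 0: "(beta_map \<beta> ^^ (g + t0)) x = 0" by (rule beta_iterate_zero_mono[OF x(3)]) simp
  have "uncut \<beta> (g + t0) x (x + 1 / \<beta> ^ (g + t0))" unfolding uncut_def
  proof
    fix y assume y: "y \<in> {x<..<x + 1 / \<beta> ^ (g + t0)}"
    then have "(beta_map \<beta> ^^ g) y = \<beta> ^ g * (y - x)"
      using uncut_imp_affine(1)[OF _ h(3), of y] x(3) th assms(1) by simp
    moreover have "\<beta> ^ (g + t0) * (y - x) < 1"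
    proof -
      have "y - x < 1 / \<beta> ^ (g + t0)" using y by auto
      then show ?thesis using assms(1) by (simp add: pos_less_divide_eq mult.commute)
    qed
    ultimately have "(beta_map \<beta> ^^ (g + t0)) y = \<beta> ^ t0 * (\<beta> ^ g * (y - x))"
      unfolding beta_iterate_add using expand[of "\<beta> ^ g * (y - x)" t0] y assms(1)
      by (simp add: power_add mult.assoc mult.left_commute)
    then show "(beta_map \<beta> ^^ (g + t0)) y \<noteq> 0" using y assms(1) by simp
  qed
  then show thesis using that[of x "g + t0"] x th h 0 by simp
qed

text \<open>All points of \<open>[a, b)\<close> share their first \<open>t + length w\<close> digits, and these end with \<open>w\<close>. Asking this
  for one digit sequence on a whole interval makes the occurrence robust.\<close>

definition word_at :: "real \<Rightarrow> nat list \<Rightarrow> nat \<Rightarrow> real \<Rightarrow> real \<Rightarrow> bool" where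
  "word_at \<beta> w t a b \<longleftrightarrow> uncut \<beta> (t + length w) a b \<and>
     (\<forall>j<length w. beta_digits \<beta> a (t + j) = w ! j)"

lemma word_at_mono:
  assumes "\<beta> > 0" "word_at \<beta> w t a b" "a \<le> a'" "a' < b" "b' \<le> b"
  shows "word_at \<beta> w t a' b'"
  using assms uncut_mono[of \<beta> "t + length w" a b "t + length w" a' b']
    uncut_imp_affine(2)[of \<beta> "t + length w" a b a']
  unfolding word_at_def by auto

lemma word_at_pullback:
  assumes "\<beta> > 0" "uncut \<beta> m a b" "a < b" "word_at \<beta> w t u v"
    "(beta_map \<beta> ^^ m) a \<le> u" "u < v" "v \<le> (beta_map \<beta> ^^ m) a + \<beta> ^ m * (b - a)"
  obtains a' b' where "a \<le> a'" "a' < b'" "b' \<le> b" "b' - a' = (v - u) / \<beta> ^ m"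
    "word_at \<beta> w (m + t) a' b'"
proof -
  obtain a' b' where *: "a \<le> a'" "a' < b'" "b' \<le> b" "b' - a' = (v - u) / \<beta> ^ m"
    "(beta_map \<beta> ^^ m) a' = u" "uncut \<beta> (m + (t + length w)) a' b'"
    using uncut_pullback[OF assms(1-3) _ assms(5-7), of "t + length w"] assms(4)
    unfolding word_at_def by metis
  have "word_at \<beta> w (m + t) a' b'" using * assms(4)
    unfolding word_at_def by (simp add: add.assoc beta_digits_add)
  then show thesis using * that by blast
qed

definition admissible :: "real \<Rightarrow> nat list \<Rightarrow> bool" where
  "admissible \<beta> w \<longleftrightarrow> (\<exists>x\<in>{0..<1}. \<forall>j<length w. beta_digits \<beta> x j = w ! j)"

text \<open>Choose a full branch inside \<open>[a, b)\<close> and pull back a cylinder of \<open>w\<close> along it.\<close>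

lemma word_at_exists:
  assumes "\<beta> > 1" "admissible \<beta> w" "0 \<le> a" "a < b" "b \<le> 1"
  obtains t a' b' where "a \<le> a'" "a' < b'" "b' \<le> b" "word_at \<beta> w t a' b'"
proof -
  obtain x where x: "x \<in> {0..<1}" "\<And>j. j < length w \<Longrightarrow> beta_digits \<beta> x j = w ! j"
    using assms(2) unfolding admissible_def by auto
  obtain h where h: "h > 0" "x + h \<le> 1" "uncut \<beta> (length w) x (x + h)"
    using exists_uncut_right[of \<beta> x 1 "length w"] x assms by auto
  have w: "word_at \<beta> w 0 x (x + h)" using h x unfolding word_at_def by simp
  obtain t y where t: "a \<le> y" "y + 1 / \<beta> ^ t \<le> b" "(beta_map \<beta> ^^ t) y = 0"
    "uncut \<beta> t y (y + 1 / \<beta> ^ t)" using full_branch[OF assms(1,3-5)] .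
  have "0 < \<beta>" "y < y + 1 / \<beta> ^ t" "(beta_map \<beta> ^^ t) y \<le> x" "x < x + h"
    "x + h \<le> (beta_map \<beta> ^^ t) y + \<beta> ^ t * (y + 1 / \<beta> ^ t - y)"
    using t h x assms(1) by auto
  then obtain a' b' where "y \<le> a'" "a' < b'" "b' \<le> y + 1 / \<beta> ^ t" "word_at \<beta> w (t + 0) a' b'"
    using word_at_pullback[OF _ t(4) _ w] by metis
  then show thesis using that[of a' b' "t + 0"] t by linarith
qed

text \<open>The length of the subinterval is bounded below uniformly: an interval of length at least
  \<open>\<eta>\<close> contains one of the finitely many intervals of a grid of mesh below \<open>\<eta> / 2\<close>.\<close>

lemma word_at_uniform_unit:
  assumes "\<beta> > 1" "admissible \<beta> w" "\<eta> > 0"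
  obtains c where "c > 0" "\<And>a b. 0 \<le> a \<Longrightarrow> b \<le> 1 \<Longrightarrow> b - a \<ge> \<eta> \<Longrightarrow>
    \<exists>t a' b'. a \<le> a' \<and> a' + c \<le> b' \<and> b' \<le> b \<and> word_at \<beta> w t a' b'"
proof -
  obtain K where K: "K > 0" "2 / \<eta> < real K"
    using reals_Archimedean2[of "2 / \<eta>"] assms(3)
    by (metis divide_pos_pos of_nat_0_less_iff order_less_trans zero_less_numeral)
  have "\<exists>t a' b'. real i / K \<le> a' \<and> a' < b' \<and> b' \<le> real (Suc i) / K \<and> word_at \<beta> w t a' b'"
    if "i < K" for i
  proof -
    have "real i / K < real (Suc i) / K" using K by (simp add: divide_strict_right_mono)
    moreover have "real (Suc i) / K \<le> 1" using that K by simp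
    ultimately show ?thesis
      using word_at_exists[OF assms(1,2), of "real i / K" "real (Suc i) / K"] by fastforce
  qed
  then obtain t a' b' where g: "\<And>i. i < K \<Longrightarrow> real i / K \<le> a' i \<and> a' i < b' i \<and>
      b' i \<le> real (Suc i) / K \<and> word_at \<beta> w (t i) (a' i) (b' i)"
    by metis
  define c where "c = Min ((\<lambda>i. b' i - a' i) ` {..<K})"
  have "c \<in> (\<lambda>i. b' i - a' i) ` {..<K}" unfolding c_def using K by (intro Min_in) auto
  then have "c > 0" using g by auto
  moreover have "\<exists>t a' b'. a \<le> a' \<and> a' + c \<le> b' \<and> b' \<le> b \<and> word_at \<beta> w t a' b'"
    if ab: "0 \<le> a" "b \<le> 1" "b - a \<ge> \<eta>" for a b
  proof -
    define i where "i = nat \<lceil>a * K\<rceil>"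
    have "0 \<le> a * K" using ab by simp
    then have ri: "a * K \<le> real i" "real i < a * K + 1" unfolding i_def by linarith+
    have "2 < K * \<eta>" using K assms(3) by (simp add: divide_less_eq)
    also have "\<dots> \<le> K * (b - a)" using ab K by (intro mult_left_mono) auto
    finally have "2 < b * K - a * K" by (simp add: algebra_simps)
    then have ib: "real (Suc i) < b * K" using ri by simp
    also have "b * K \<le> 1 * real K" using ab K by (intro mult_right_mono) auto
    finally have iK: "i < K" by simp
    have "c \<le> b' i - a' i" unfolding c_def using iK by simp
    moreover have "a \<le> real i / K" "real (Suc i) / K \<le> b"
      using ri ib K by (simp_all add: pos_le_divide_eq pos_divide_le_eq)
    ultimately show ?thesis using g[OF iK] 
      by (intro exI[of _ "t i"] exI[of _ "a' i"] exI[of _ "b' i"]) linarith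
  qed
  ultimately show thesis by (rule that)
qed

text \<open>The previous bound, transported to small scales by the affine map \<open>f\<^sup>m\<close>. Only the length of the
  image of \<open>[a, b)\<close> under \<open>f\<^sup>m\<close> matters.\<close>

lemma word_at_uniform:
  assumes "\<beta> > 1" "admissible \<beta> w" "\<eta> > 0"
  obtains c where "c > 0" "\<And>a b m. 0 \<le> a \<Longrightarrow> a < b \<Longrightarrow> b \<le> 1 \<Longrightarrow> uncut \<beta> m a b \<Longrightarrow>
    \<beta> ^ m * (b - a) \<ge> \<eta> \<Longrightarrow>
    \<exists>t a' b'. a \<le> a' \<and> a' + c * (b - a) \<le> b' \<and> b' \<le> b \<and> t \<ge> m \<and> word_at \<beta> w t a' b'"
proof -
  obtain c where c: "c > 0" "\<And>a b. 0 \<le> a \<Longrightarrow> b \<le> 1 \<Longrightarrow> b - a \<ge> \<eta> \<Longrightarrow>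
    \<exists>t a' b'. a \<le> a' \<and> a' + c \<le> b' \<and> b' \<le> b \<and> word_at \<beta> w t a' b'"
    using word_at_uniform_unit[OF assms] by metis
  have "\<exists>t a' b'. a \<le> a' \<and> a' + c * (b - a) \<le> b' \<and> b' \<le> b \<and> t \<ge> m \<and> word_at \<beta> w t a' b'"
    if ab: "0 \<le> a" "a < b" "b \<le> 1" and un: "uncut \<beta> m a b" and \<eta>: "\<beta> ^ m * (b - a) \<ge> \<eta>" for a b m
  proof -
    let ?fa = "(beta_map \<beta> ^^ m) a"
    have fa: "?fa + \<beta> ^ m * (b - a) \<le> 1" "0 \<le> ?fa"
      using uncut_imp_short[OF _ un ab] beta_iterate_range[of a m \<beta>] ab assms(1) by auto
    then obtain t u v where u: "?fa \<le> u" "u + c \<le> v" "v \<le> ?fa + \<beta> ^ m * (b - a)" "word_at \<beta> w t u v"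
      using c(2)[of ?fa "?fa + \<beta> ^ m * (b - a)"] \<eta> by auto
    obtain a' b' where *: "a \<le> a'" "a' < b'" "b' \<le> b" "b' - a' = (v - u) / \<beta> ^ m"
      "word_at \<beta> w (m + t) a' b'"
      using word_at_pullback[OF _ un ab(2) u(4,1) _ u(3)] u(2) c(1) assms(1) by auto
    have "c * (b - a) \<le> c / \<beta> ^ m"
    proof -
      have "b - a \<le> 1 / \<beta> ^ m" using fa assms(1) by (subst pos_le_divide_eq) (auto simp: mult.commute)
      then have "c * (b - a) \<le> c * (1 / \<beta> ^ m)" using c(1) by (intro mult_left_mono) auto
      then show ?thesis by simp
    qed
    also have "\<dots> \<le> (v - u) / \<beta> ^ m" using u(2) assms(1) by (intro divide_right_mono) auto
    finally show ?thesis using * by (intro exI[of _ "m + t"] exI[of _ a'] exI[of _ b']) auto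
  qed
  then show thesis using c(1) that by blast
qed

text \<open>The words for several maps are imposed one after the other. Each passage to a subinterval shrinks
  the image under the remaining maps by a fixed factor, so the previous lemma still applies,
  with a smaller \<open>\<eta>\<close>.\<close>

lemma word_at_simultaneous:
  assumes "finite S" "\<And>n. n \<in> S \<Longrightarrow> \<beta> n > 1" "\<And>n. n \<in> S \<Longrightarrow> admissible (\<beta> n) (w n)"
    "\<And>n. n \<in> S \<Longrightarrow> \<eta> n > 0"
  shows "\<exists>c>0. c \<le> 1 \<and> (\<forall>a b m. 0 \<le> a \<longrightarrow> a < b \<longrightarrow> b \<le> 1 \<longrightarrow>
      (\<forall>n\<in>S. uncut (\<beta> n) (m n) a b \<and> \<beta> n ^ m n * (b - a) \<ge> \<eta> n) \<longrightarrow>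
      (\<exists>a' b'. a \<le> a' \<and> a' + c * (b - a) \<le> b' \<and> b' \<le> b \<and>
         (\<forall>n\<in>S. \<exists>t\<ge>m n. word_at (\<beta> n) (w n) t a' b')))"
    (is "\<exists>c>0. c \<le> 1 \<and> (\<forall>a b m. ?P S c a b m)")
  using assms
proof (induction S rule: finite_induct)
  case empty
  have "?P {} 1 a b m" for a b m
    by (intro impI exI[of _ a] exI[of _ b]) simp
  then show ?case by (intro exI[of _ 1] conjI allI) auto
next
  case (insert k S)
  have "\<exists>c>0. c \<le> 1 \<and> (\<forall>a b m. ?P S c a b m)"
    by (rule insert.IH) (use insert.prems in auto)
  then obtain c where c: "c > 0" "c \<le> 1" and IH: "\<forall>a b m. ?P S c a b m" by (elim exE conjE)
  have k: "\<beta> k > 1" "admissible (\<beta> k) (w k)" "\<eta> k * c > 0" using insert.prems c by auto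
  obtain d where d: "d > 0" and kd: "\<And>a b m. 0 \<le> a \<Longrightarrow> a < b \<Longrightarrow> b \<le> 1 \<Longrightarrow> uncut (\<beta> k) m a b \<Longrightarrow>
    \<beta> k ^ m * (b - a) \<ge> \<eta> k * c \<Longrightarrow>
    \<exists>t a' b'. a \<le> a' \<and> a' + d * (b - a) \<le> b' \<and> b' \<le> b \<and> t \<ge> m \<and> word_at (\<beta> k) (w k) t a' b'"
    using word_at_uniform[OF k] by metis
  define d' where "d' = min d 1"
  have d': "d' > 0" "d' \<le> 1" "d' \<le> d" using d unfolding d'_def by auto
  show ?case
  proof (rule exI[of _ "d' * c"], intro conjI allI impI)
    show "d' * c > 0" "d' * c \<le> 1" using c d' by (auto simp: mult_le_one)
    fix a b :: real and m :: "_ \<Rightarrow> nat"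
    assume ab: "0 \<le> a" "a < b" "b \<le> 1"
      and m: "\<forall>n\<in>insert k S. uncut (\<beta> n) (m n) a b \<and> \<beta> n ^ m n * (b - a) \<ge> \<eta> n"
    obtain a' b' where 1: "a \<le> a'" "a' + c * (b - a) \<le> b'" "b' \<le> b"
       "\<And>n. n \<in> S \<Longrightarrow> \<exists>t\<ge>m n. word_at (\<beta> n) (w n) t a' b'" 
      using IH[THEN spec, THEN spec, THEN spec, of a b m] ab m by blast
    have "c * (b - a) > 0" using c ab by simp
    then have ab': "a' < b'" using 1 by linarith
    have un: "uncut (\<beta> k) (m k) a' b'" using m 1 uncut_mono by blast
    have "\<eta> k * c \<le> \<beta> k ^ m k * (b - a) * c" using m c by (intro mult_right_mono) auto
    also have "\<dots> = \<beta> k ^ m k * (c * (b - a))" by simp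
    also have "\<dots> \<le> \<beta> k ^ m k * (b' - a')" using 1 k(1) by (intro mult_left_mono) auto
    finally obtain t a2 b2 where 2: "a' \<le> a2" "a2 + d * (b' - a') \<le> b2" "b2 \<le> b'" "t \<ge> m k"
      "word_at (\<beta> k) (w k) t a2 b2" using kd[OF _ ab' _ un] ab 1 by auto
    have "d * (b' - a') > 0" using d ab' by simp
    then have lt: "a2 < b'" using 2 by linarith
    have "word_at (\<beta> n) (w n) t a2 b2" if "n \<in> S" "word_at (\<beta> n) (w n) t a' b'" for n t
      by (rule word_at_mono[OF _ that(2)]) (use insert.prems(1)[of n] that 2 lt in auto)
    then have "\<forall>n\<in>insert k S. \<exists>t\<ge>m n. word_at (\<beta> n) (w n) t a2 b2" using 1(4) 2 by blast
    moreover have "a2 + d' * c * (b - a) \<le> b2"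
    proof -
      have "d' * c * (b - a) \<le> d * (b' - a')" 
        using d' 1 c ab ab' unfolding mult.assoc by (intro mult_mono) auto
      then show ?thesis using 2 by linarith
    qed
    ultimately show "\<exists>a' b'. a \<le> a' \<and> a' + d' * c * (b - a) \<le> b' \<and> b' \<le> b \<and>
       (\<forall>n\<in>insert k S. \<exists>t\<ge>m n. word_at (\<beta> n) (w n) t a' b')"
      using 1 2 by (intro exI[of _ a2] exI[of _ b2]) auto
  qed
qed

section \<open>Recurring words keep an orbit away from a subshift\<close>

text \<open>What taking the closure means here: every finite prefix is that of a genuine expansion.\<close>

lemma beta_shift_prefix:
  assumes "s \<in> beta_shift \<beta>"
  obtains x where "x \<in> {0..<1}" "\<And>i. i < n \<Longrightarrow> beta_digits \<beta> x i = s i"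
proof -
  let ?U = "\<Inter>i\<in>{..<n}. (\<lambda>t::nat \<Rightarrow> nat. t i) -` {s i}"
  have "open ?U" by (intro open_INT finite_lessThan ballI open_vimage open_discrete) simp
  moreover have "s \<in> ?U" by simp
  ultimately have "?U \<inter> beta_digits \<beta> ` {0..<1} \<noteq> {}"
    using assms open_Int_closure_eq_empty[of ?U] unfolding beta_shift_def by blast
  then obtain x where "x \<in> {0..<1}" "beta_digits \<beta> x \<in> ?U" by blast
  then show thesis using that[of x] by simp
qed

lemma admissible_if_word_occurs:
  assumes "word_occurs w (beta_shift \<beta>)"
  shows "admissible \<beta> w"
proof -
  obtain s m where s: "s \<in> beta_shift \<beta>" "\<And>j. j < length w \<Longrightarrow> s (m + j) = w ! j"
    using assms unfolding word_occurs_def by auto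
  obtain x where x: "x \<in> {0..<1}" "\<And>i. i < m + length w \<Longrightarrow> beta_digits \<beta> x i = s i"
    using beta_shift_prefix[OF s(1)] by metis
  have "\<forall>j<length w. beta_digits \<beta> ((beta_map \<beta> ^^ m) x) j = w ! j"
    using x(2) s(2) by (simp flip: beta_digits_add)
  then show ?thesis using beta_iterate_range[OF x(1)] unfolding admissible_def by blast
qed

text \<open>A point of the shift need not be the greedy expansion of its projection, but its tails still have
  values in the unit interval. The value \<open>1\<close> is possible.\<close>

lemma beta_shift_tail:
  assumes "s \<in> beta_shift \<beta>" "\<beta> > 1"
  shows "summable (\<lambda>k. real (s (j + k)) / \<beta> ^ (k + 1))"
    and "(\<Sum>k. real (s (j + k)) / \<beta> ^ (k + 1)) \<in> {0..1}"
proof -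
  have le: "(\<Sum>k<n. real (s (j + k)) / \<beta> ^ (k + 1)) \<le> 1" for n
  proof -
    obtain x where x: "x \<in> {0..<1}" "\<And>i. i < j + n \<Longrightarrow> beta_digits \<beta> x i = s i"
      using beta_shift_prefix[OF assms(1)] by metis
    let ?y = "(beta_map \<beta> ^^ j) x"
    have y: "?y \<in> {0..<1}" by (rule beta_iterate_range[OF x(1)])
    have "(\<Sum>k<n. real (s (j + k)) / \<beta> ^ (k + 1)) = (\<Sum>k<n. real (beta_digits \<beta> ?y k) / \<beta> ^ (k + 1))"
      using x(2) by (intro sum.cong) (simp_all flip: beta_digits_add)
    also have "\<dots> = ?y - (beta_map \<beta> ^^ n) ?y / \<beta> ^ n"
      by (rule beta_digits_sum) (use assms y in auto)
    also have "\<dots> \<le> 1" using y beta_iterate_range[OF y, of n \<beta>] assms(2)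
      by (smt (verit) atLeastLessThan_iff divide_nonneg_pos zero_less_power)
    finally show ?thesis .
  qed
  show sum: "summable (\<lambda>k. real (s (j + k)) / \<beta> ^ (k + 1))"
    by (rule summableI_nonneg_bounded[of _ 1]) (use le assms(2) in auto)
  have "(\<Sum>k. real (s (j + k)) / \<beta> ^ (k + 1)) \<le> 1"
    by (rule suminf_le_const[OF sum le])
  moreover have "(\<Sum>k. real (s (j + k)) / \<beta> ^ (k + 1)) \<ge> 0"
    using assms(2) by (intro suminf_nonneg[OF sum]) simp
  ultimately show "(\<Sum>k. real (s (j + k)) / \<beta> ^ (k + 1)) \<in> {0..1}" by simp
qed

text \<open>Greedy digits can differ from \<open>s\<close> only because some tail of \<open>s\<close> has value \<open>1\<close>, and then
  the orbit of the projection hits \<open>0\<close> at that time.\<close>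

lemma digits_beta_proj:
  assumes "s \<in> beta_shift \<beta>" "\<beta> > 1" "(beta_map \<beta> ^^ n) (beta_proj \<beta> s) \<noteq> 0" "i < n"
  shows "beta_digits \<beta> (beta_proj \<beta> s) i = s i"
proof -
  let ?T = "\<lambda>j. \<Sum>k. real (s (j + k)) / \<beta> ^ (k + 1)"
  let ?e = "\<lambda>j. (beta_map \<beta> ^^ j) (beta_proj \<beta> s)"
  have T: "\<beta> * ?T j = real (s j) + ?T (Suc j)" for j
  proof -
    have sum: "summable (\<lambda>k. real (s (j + k)) / \<beta> ^ (k + 1))" by (rule beta_shift_tail[OF assms(1,2)])
    have "\<beta> * ?T j = (\<Sum>k. real (s (j + k)) / \<beta> ^ k)"
      using assms(2) by (subst suminf_mult[OF sum, symmetric]) (auto simp: field_simps)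
    also have "\<dots> = real (s j) + ?T (Suc j)"
    proof -
      have "summable (\<lambda>k. real (s (j + k)) / \<beta> ^ k)"
        using summable_mult[OF sum, of \<beta>] assms(2) by (simp add: field_simps)
      from suminf_split_head[OF this] show ?thesis by simp
    qed
    finally show ?thesis .
  qed
  have nz: "?e j \<noteq> 0" if "j \<le> n" for j
    using beta_iterate_zero_mono[of j \<beta> "beta_proj \<beta> s" n] that assms(3) by blast
  have dig: "\<lfloor>\<beta> * ?e j\<rfloor> = int (s j) \<and> ?e (Suc j) = ?T (Suc j)" if "?e j = ?T j" "j < n" for j
  proof -
    have eq: "\<beta> * ?e j = real (s j) + ?T (Suc j)" using T[of j] that(1) by simp
    \<comment> \<open>a tail of value \<open>1\<close> would make \<open>\<beta> f\<^sup>j(e)\<close> an integer\<close>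
    have "?T (Suc j) \<noteq> 1"
    proof
      assume "?T (Suc j) = 1"
      then have "?e (Suc j) = frac (real (s j) + 1)" using eq by (simp add: beta_map_def[of \<beta> "?e j"])
      also have "\<dots> = 0" by (simp add: frac_def)
      finally show False using nz[of "Suc j"] that by simp
    qed
    then have T1: "0 \<le> ?T (Suc j)" "?T (Suc j) < 1"
      using beta_shift_tail(2)[OF assms(1,2), of "Suc j"] by auto
    have fl: "\<lfloor>\<beta> * ?e j\<rfloor> = int (s j)"
      unfolding eq by (rule floor_unique) (use T1 in auto)
    moreover have "?e (Suc j) = ?T (Suc j)"
      using fl eq by (simp add: beta_map_def[of \<beta> "?e j"] frac_def)
    ultimately show ?thesis by blast
  qed
  have "?e j = ?T j" if "j < n" for j
    using that by (induction j) (use dig in \<open>auto simp: beta_proj_def\<close>)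
  then show ?thesis using dig[OF _ assms(4)] assms(4) unfolding beta_digits_def by simp
qed

text \<open>The scales \<open>r l\<^sup>k\<close> decrease geometrically, so that every \<open>\<rho> \<beta>\<^sup>-\<^sup>m\<close> is comparable to one
  of them. The bound by \<open>D\<close> ensures that the occurrence of \<open>w\<close> at that scale comes at time \<open>m\<close> or later.\<close>

lemma orbit_avoiding_if_word_recurs:
  assumes \<beta>: "\<beta> > 1" and \<Sigma>: "\<Sigma> \<subseteq> beta_shift \<beta>" "\<not> word_occurs w \<Sigma>"
    and pos: "r > 0" "0 < l" "l < 1" "D > 0"
    and rec: "\<And>k. \<exists>t. word_at \<beta> w t (y - r * l ^ k) (y + r * l ^ k) \<and>
       0 \<le> y - r * l ^ k \<and> y + r * l ^ k \<le> 1 \<and> \<beta> ^ t * (r * l ^ k) \<ge> D"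
  shows "y \<in> orbit_avoiding (beta_map \<beta>) (beta_proj \<beta> ` \<Sigma>)"
proof -
  \<comment> \<open>The bound by \<open>r\<close> makes the scale \<open>\<rho> \<beta>\<^sup>-\<^sup>m\<close> at most \<open>r\<close>. The factor \<open>l\<close> makes up for rounding
    it up to one of the scales \<open>r l\<^sup>k\<close>.\<close>
  define \<rho> where "\<rho> = min r (D * l)"
  have \<rho>: "\<rho> > 0" "\<rho> \<le> r" "\<rho> \<le> D * l" using pos unfolding \<rho>_def by auto
  have far: "dist ((beta_map \<beta> ^^ m) y) e \<ge> \<rho>" if e: "e \<in> beta_proj \<beta> ` \<Sigma>" for e m
  proof (rule ccontr)
    assume "\<not> ?thesis"
    then have close: "\<bar>e - (beta_map \<beta> ^^ m) y\<bar> < \<rho>" by (simp add: dist_real_def abs_minus_commute)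
    obtain s where s: "s \<in> \<Sigma>" "e = beta_proj \<beta> s" using e by auto
    have bm: "\<beta> ^ m \<ge> 1" using \<beta> by simp
    define R where "R = \<rho> / \<beta> ^ m"
    have R: "R > 0" "R \<le> r" using \<rho> bm pos unfolding R_def
      by (auto simp: divide_le_eq intro: order_trans[OF \<rho>(2)] mult_left_mono[of 1 "\<beta> ^ m" r, simplified])
    have "\<exists>k. r * l ^ k < R"
    proof -
      obtain k where "l ^ k < R / r" using real_arch_pow_inv[of "R / r" l] R pos by auto
      then show ?thesis using pos by (auto simp: field_simps)
    qed
    then obtain k where k: "r * l ^ Suc k < R" "R \<le> r * l ^ k"
    proof -
      define k where "k = (LEAST k. r * l ^ k < R)"
      have "r * l ^ k < R" using LeastI_ex[OF \<open>\<exists>k. r * l ^ k < R\<close>] unfolding k_def .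
      moreover then obtain k' where "k = Suc k'" using R by (cases k) auto
      moreover then have "\<not> r * l ^ k' < R" using not_less_Least[of k' "\<lambda>k. r * l ^ k < R"] unfolding k_def by simp
      ultimately show thesis using that[of k'] by simp
    qed
    let ?a = "y - r * l ^ k" and ?b = "y + r * l ^ k"
    obtain t where t: "word_at \<beta> w t ?a ?b" "0 \<le> ?a" "?b \<le> 1" "\<beta> ^ t * (r * l ^ k) \<ge> D"
      using rec[of k] by blast
    have rk: "r * l ^ k > 0" using pos by simp
    have "\<beta> ^ m \<le> \<beta> ^ t"
    proof -
      have "\<beta> ^ m * (r * l ^ k) * l < \<beta> ^ m * R"
        using k(1) bm by (simp add: mult.assoc mult.commute[of l])
      also have "\<dots> = \<rho>" using \<beta> unfolding R_def by simp
      also have "\<dots> \<le> \<beta> ^ t * (r * l ^ k) * l"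
        using \<rho>(3) mult_right_mono[OF t(4), of l] pos by linarith
      finally have "\<beta> ^ m < \<beta> ^ t" using rk pos by simp
      then show ?thesis by simp
    qed
    then have mt: "m \<le> t" using \<beta> power_le_imp_le_exp by blast
    have un: "uncut \<beta> (t + length w) ?a ?b" using t(1) unfolding word_at_def by blast
    \<comment> \<open>the point near \<open>y\<close> that \<open>f\<^sup>m\<close> maps to \<open>e\<close>\<close>
    define x where "x = y + (e - (beta_map \<beta> ^^ m) y) / \<beta> ^ m"
    have "\<bar>x - y\<bar> < R"
      using close bm unfolding x_def R_def by (simp add: divide_strict_right_mono)
    then have x: "x \<in> {?a<..<?b}" using k(2) by auto
    have unm: "uncut \<beta> m ?a ?b" using uncut_mono[OF un, of m] mt by simp
    have aff: "(beta_map \<beta> ^^ m) z = (beta_map \<beta> ^^ m) ?a + \<beta> ^ m * (z - ?a)" if "z \<in> {?a..<?b}" for z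
      using uncut_imp_affine(1)[OF _ unm that] \<beta> by simp
    have "(beta_map \<beta> ^^ m) x - (beta_map \<beta> ^^ m) y = \<beta> ^ m * (x - y)"
      using aff[of x] aff[of y] x rk by (simp add: algebra_simps)
    also have "\<dots> = e - (beta_map \<beta> ^^ m) y" using \<beta> unfolding x_def by simp
    finally have fx: "(beta_map \<beta> ^^ m) x = e" by simp
    define L where "L = t + length w - m"
    have tL: "t + length w = m + L" using mt unfolding L_def by simp
    have "(beta_map \<beta> ^^ L) e \<noteq> 0"
      using un x unfolding uncut_def tL beta_iterate_add fx by (metis fx)
    then have dig: "beta_digits \<beta> e i = s i" if "i < L" for i
      using digits_beta_proj[OF _ \<beta>, of s L i] s \<Sigma>(1) that by blast
    have "s ((t - m) + j) = w ! j" if j: "j < length w" for j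
    proof -
      have "s ((t - m) + j) = beta_digits \<beta> e ((t - m) + j)"
        using dig j mt unfolding L_def by simp
      also have "\<dots> = beta_digits \<beta> x (t + j)"
        using mt by (simp flip: fx beta_digits_add)
      also have "\<dots> = beta_digits \<beta> ?a (t + j)"
        using uncut_imp_affine(2)[OF _ un, of x "t + j"] x j \<beta> by simp
      also have "\<dots> = w ! j" using t(1) j unfolding word_at_def by blast
      finally show ?thesis .
    qed
    then show False using \<Sigma>(2) s(1) unfolding word_occurs_def by blast
  qed
  have "e \<notin> closure (\<Union>m. {(beta_map \<beta> ^^ m) y})" if "e \<in> beta_proj \<beta> ` \<Sigma>" for e
  proof
    assume "e \<in> closure (\<Union>m. {(beta_map \<beta> ^^ m) y})"
    then obtain z where "z \<in> (\<Union>m. {(beta_map \<beta> ^^ m) y})" "dist z e < \<rho>"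
      using \<rho>(1) unfolding closure_approachable by blast
    then obtain m where "dist ((beta_map \<beta> ^^ m) y) e < \<rho>" by blast
    then show False using far[OF that, of m] by linarith
  qed
  moreover have "y \<in> {0..<1}"
  proof -
    have "0 \<le> y - r * l ^ 0" "y + r * l ^ 0 \<le> 1" using rec[of 0] by blast+
    then show ?thesis using pos by simp
  qed
  ultimately show ?thesis unfolding orbit_avoiding_def by blast
qed

section \<open>Hausdorff measure on the real line\<close>

text \<open>A cover of \<open>A\<close> by sets \<open>U\<^sub>i\<close> pulls back to a cover of the unit interval by sets of diameter at most
  \<open>C (diameter U\<^sub>i)\<^sup>s\<close>, and Lebesgue measure is countably subadditive. The exponent \<open>0\<close> is included because
  \<open>diam_weight\<close> then gives weight \<open>1\<close> to every nonempty set.\<close>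

lemma hausdorff_measure_nonzero:
  fixes g :: "real \<Rightarrow> 'a::metric_space"
  assumes s: "s \<ge> 0" and C: "C > 0"
    and g: "\<And>x x'. x \<in> {0..<1} \<Longrightarrow> x' \<in> {0..<1} \<Longrightarrow> x \<noteq> x' \<Longrightarrow>
      g x \<noteq> g x' \<and> \<bar>x - x'\<bar> \<le> C * dist (g x) (g x') powr s"
    and A: "g ` {0..<1} \<subseteq> A"
  shows "hausdorff_measure s A \<noteq> 0"
proof -
  have bound: "ennreal (1 / (2 * C)) \<le> (\<Sum>i. diam_weight s (U i))"
    if U: "A \<subseteq> (\<Union>i. U i)" "\<And>i. bounded (U i)" for U :: "nat \<Rightarrow> 'a set"
  proof -
    have ex: "\<forall>i. \<exists>J. J \<in> sets lborel \<and> {x\<in>{0..<1}. g x \<in> U i} \<subseteq> J \<and>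
        emeasure lborel J \<le> ennreal (2 * C) * diam_weight s (U i)"
    proof
      fix i :: nat
      show "\<exists>J. J \<in> sets lborel \<and> {x\<in>{0..<1}. g x \<in> U i} \<subseteq> J \<and>
        emeasure lborel J \<le> ennreal (2 * C) * diam_weight s (U i)"
      proof (cases "{x\<in>{0..<1}. g x \<in> U i} = {}")
        case True
        then show ?thesis by (intro exI[of _ "{}"]) auto
      next
        case False
        then obtain x0 where x0: "x0 \<in> {0..<1}" "g x0 \<in> U i" by auto
        define W where "W = (if s = 0 then 1 else diameter (U i) powr s)"
        have W: "diam_weight s (U i) = ennreal W" "W \<ge> 0"
          using x0 unfolding diam_weight_def W_def by auto
        have "x \<in> {x0 - C * W..x0 + C * W}" if x: "x \<in> {0..<1}" "g x \<in> U i" for x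
        proof (cases "x = x0")
          case True
          then show ?thesis using W C by simp
        next
          case False
          then have "g x \<noteq> g x0" and le: "\<bar>x - x0\<bar> \<le> C * dist (g x) (g x0) powr s"
            using g x x0 by blast+
          moreover have "dist (g x) (g x0) powr s \<le> W"
          proof -
            have "dist (g x) (g x0) \<le> diameter (U i)"
              using diameter_bounded_bound[OF U(2)] x x0 by blast
            then show ?thesis using s \<open>g x \<noteq> g x0\<close> unfolding W_def by (auto intro: powr_mono2)
          qed
          ultimately have "\<bar>x - x0\<bar> \<le> C * W" using C by (meson mult_left_mono order_trans less_imp_le)
          then show ?thesis by auto
        qed
        moreover have "emeasure lborel {x0 - C * W..x0 + C * W} = ennreal (2 * C) * ennreal W"
          using C W by (simp add: ennreal_mult[symmetric])
        ultimately show ?thesis unfolding W(1)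
          by (intro exI[of _ "{x0 - C * W..x0 + C * W}"]) auto
      qed
    qed
    obtain J where "\<forall>i. J i \<in> sets lborel \<and> {x\<in>{0..<1}. g x \<in> U i} \<subseteq> J i \<and>
        emeasure lborel (J i) \<le> ennreal (2 * C) * diam_weight s (U i)"
      using choice[OF ex] by (elim exE)
    then have J: "J i \<in> sets lborel" "{x\<in>{0..<1}. g x \<in> U i} \<subseteq> J i"
      "emeasure lborel (J i) \<le> ennreal (2 * C) * diam_weight s (U i)" for i by blast+
    have "{0..<1} \<subseteq> (\<Union>i. J i)" using A U(1) J(2) by blast
    then have "emeasure lborel {0..<1::real} \<le> emeasure lborel (\<Union>i. J i)"
      using J(1) by (intro emeasure_mono) auto
    also have "\<dots> \<le> (\<Sum>i. emeasure lborel (J i))"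
      using J(1) by (intro emeasure_subadditive_countably) auto
    also have "\<dots> \<le> (\<Sum>i. ennreal (2 * C) * diam_weight s (U i))"
      by (intro suminf_le J(3) summableI)
    also have "\<dots> = ennreal (2 * C) * (\<Sum>i. diam_weight s (U i))" by simp
    finally have "1 \<le> ennreal (2 * C) * (\<Sum>i. diam_weight s (U i))" by simp
    then have "ennreal (1 / (2 * C)) * 1 \<le> ennreal (1 / (2 * C)) * (ennreal (2 * C) * (\<Sum>i. diam_weight s (U i)))"
      by (intro mult_left_mono) auto
    also have "\<dots> = (\<Sum>i. diam_weight s (U i))"
      using C by (simp flip: mult.assoc ennreal_mult)
    finally show ?thesis by simp
  qed
  have "0 < ennreal (1 / (2 * C))" using C by simp
  also have "\<dots> \<le> hausdorff_premeasure s 1 A"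
    unfolding hausdorff_premeasure_def by (rule INF_greatest) (use bound in auto)
  also have "\<dots> \<le> hausdorff_measure s A"
    unfolding hausdorff_measure_def by (rule SUP_upper) simp
  finally show ?thesis by simp
qed

text \<open>Intervals of lengths proportional to \<open>\<eta> / k\<close>, laid end to end in both directions, cover the whole
  line because the harmonic series diverges, while \<open>\<Sum>k. (\<eta> / k)\<^sup>s\<close> converges and tends to \<open>0\<close>
  with \<open>\<eta>\<close>.\<close>

lemma hausdorff_measure_real_zero:
  fixes A :: "real set"
  assumes s: "s > 1"
  shows "hausdorff_measure s A = 0"
proof -
  have sum: "summable (\<lambda>k. 1 / real (Suc k) powr s)"
    using summable_Suc_iff[of "\<lambda>k. real k powr (- s)"] summable_real_powr_iff[of "- s"] s
    by (simp add: powr_minus field_simps)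
  define Z where "Z = (\<Sum>k. 1 / real (Suc k) powr s)"
  have le: "hausdorff_premeasure s \<delta> A \<le> ennreal (\<eta> powr s * Z)" if \<eta>: "0 < \<eta>" "\<eta> \<le> \<delta>" for \<eta> \<delta>
  proof -
    define h where "h k = \<eta> / 2 * harm k" for k :: nat
    define I where "I k = {h k..h (Suc k)}" for k
    \<comment> \<open>positive half-line on even indices, negative half-line on odd ones\<close>
    define U where "U k = (if even k then I (k div 2) else uminus ` I (k div 2))" for k
    have hS: "h (Suc k) = h k + \<eta> / 2 / real (Suc k)" for k
      unfolding h_def by (simp add: harm_Suc field_simps)
    have dI: "diameter (U k) \<le> \<eta> / real (Suc k)" "bounded (U k)" "U k \<noteq> {}" for k
    proof -
      have "dist x x' \<le> \<eta> / 2 / real (Suc (k div 2))" if "x \<in> U k" "x' \<in> U k" for x x'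
        using that unfolding U_def I_def hS by (auto simp: dist_real_def split: if_splits)
      moreover have "\<eta> / 2 / real (Suc (k div 2)) \<le> \<eta> / real (Suc k)"
      proof -
        have "Suc k \<le> 2 * Suc (k div 2)" by presburger
        then have "real (Suc k) \<le> 2 * real (Suc (k div 2))" by linarith
        then have "\<eta> / (2 * real (Suc (k div 2))) \<le> \<eta> / real (Suc k)"
          using \<eta> by (intro divide_left_mono) auto
        then show ?thesis by simp
      qed
      ultimately have d: "dist x x' \<le> \<eta> / real (Suc k)" if "x \<in> U k" "x' \<in> U k" for x x'
        using that by (meson order_trans)
      have "h (k div 2) \<in> I (k div 2)" unfolding I_def hS using \<eta> by simp
      then show ne: "U k \<noteq> {}" unfolding U_def by auto
      show "diameter (U k) \<le> \<eta> / real (Suc k)"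
        by (rule diameter_le) (use d ne in \<open>auto simp: dist_norm\<close>)
      show "bounded (U k)" unfolding U_def I_def
        by (simp add: bounded_uminus)
    qed
    have I: "\<exists>k. x \<in> I k" if "x \<ge> 0" for x
    proof -
      have "\<exists>k. x < h k"
      proof -
        have "eventually (\<lambda>k. 2 * x / \<eta> < harm k) sequentially"
          using harm_at_top filterlim_at_top_dense by blast
        then obtain k where "2 * x / \<eta> < harm k" by (meson eventually_sequentially order_refl)
        then show ?thesis using \<eta> unfolding h_def by (intro exI[of _ k]) (simp add: field_simps)
      qed
      define k where "k = (LEAST k. x < h k)"
      have k: "x < h k" using LeastI_ex[OF \<open>\<exists>k. x < h k\<close>] unfolding k_def .
      moreover have "h 0 = 0" by (simp add: h_def harm_def)
      ultimately have "k \<noteq> 0" using that by (metis not_less)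
      then obtain k' where k': "k = Suc k'" using not0_implies_Suc by blast
      then have "\<not> x < h k'" using not_less_Least[of k' "\<lambda>k. x < h k"] unfolding k_def by simp
      then show ?thesis using k k' unfolding I_def by (intro exI[of _ k']) auto
    qed
    have cover: "A \<subseteq> (\<Union>k. U k)"
    proof
      fix x
      obtain k where k: "\<bar>x\<bar> \<in> I k" using I[of "\<bar>x\<bar>"] by auto
      show "x \<in> (\<Union>k. U k)"
      proof (cases "x \<ge> 0")
        case True
        then have "x \<in> U (2 * k)" using k unfolding U_def by simp
        then show ?thesis by blast
      next
        case False
        then have "- x \<in> I k" using k by simp
        then have "x \<in> uminus ` I k" by (intro image_eqI[of _ _ "- x"]) auto
        then have "x \<in> U (Suc (2 * k))" unfolding U_def by simp
        then show ?thesis by blast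
      qed
    qed
    have "\<eta> / real (Suc k) \<le> \<delta>" for k
    proof -
      have "\<eta> / real (Suc k) \<le> \<eta> / 1" using \<eta> by (intro divide_left_mono) auto
      then show ?thesis using \<eta> by simp
    qed
    then have "hausdorff_premeasure s \<delta> A \<le> (\<Sum>k. diam_weight s (U k))"
      unfolding hausdorff_premeasure_def
      by (intro INF_lower) (use cover dI order_trans in blast)
    also have "\<dots> \<le> (\<Sum>k. ennreal (\<eta> powr s * (1 / real (Suc k) powr s)))"
    proof (intro suminf_le summableI)
      fix k
      have "diameter (U k) powr s \<le> (\<eta> / real (Suc k)) powr s"
        using dI[of k] diameter_ge_0[OF dI(2)[of k]] s by (intro powr_mono2) auto
      also have "\<dots> = \<eta> powr s * (1 / real (Suc k) powr s)" using \<eta> by (simp add: powr_divide)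
      finally show "diam_weight s (U k) \<le> ennreal (\<eta> powr s * (1 / real (Suc k) powr s))"
        using dI(3)[of k] s unfolding diam_weight_def by (simp add: ennreal_leI)
    qed
    also have "\<dots> = ennreal (\<Sum>k. \<eta> powr s * (1 / real (Suc k) powr s))"
      by (rule suminf_ennreal2[OF _ summable_mult[OF sum]]) simp
    also have "(\<Sum>k. \<eta> powr s * (1 / real (Suc k) powr s)) = \<eta> powr s * Z"
      unfolding Z_def by (rule suminf_mult[OF sum])
    finally show ?thesis .
  qed
  have "hausdorff_premeasure s \<delta> A = 0" if \<delta>: "\<delta> > 0" for \<delta>
  proof -
    have "(\<lambda>n. (\<delta> / real (Suc n)) powr s * Z) \<longlonglongrightarrow> 0"
      using \<delta> s by real_asymp
    then have "(\<lambda>n. ennreal ((\<delta> / real (Suc n)) powr s * Z)) \<longlonglongrightarrow> ennreal 0"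
      by (rule tendsto_ennrealI)
    moreover have "hausdorff_premeasure s \<delta> A \<le> ennreal ((\<delta> / real (Suc n)) powr s * Z)" for n
      by (rule le) (use \<delta> in \<open>auto simp: divide_le_eq\<close>)
    ultimately have "hausdorff_premeasure s \<delta> A \<le> ennreal 0"
      by (intro LIMSEQ_le_const) auto
    then show ?thesis by simp
  qed
  then show ?thesis unfolding hausdorff_measure_def by simp
qed

lemma hausdorff_dim_eq_1:
  fixes A :: "real set"
  assumes "\<And>s. 0 \<le> s \<Longrightarrow> s < 1 \<Longrightarrow> hausdorff_measure s A \<noteq> 0"
  shows "hausdorff_dim A = 1"
proof (rule antisym)
  show "hausdorff_dim A \<le> 1"
  proof (rule ereal_le_epsilon2)
    fix e :: real assume "e > 0"
    then have "hausdorff_dim A \<le> ereal (1 + e)" unfolding hausdorff_dim_def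
      by (intro Inf_lower) (use hausdorff_measure_real_zero[of "1 + e" A] in auto)
    then show "hausdorff_dim A \<le> 1 + ereal e" by (simp add: one_ereal_def)
  qed
  show "1 \<le> hausdorff_dim A" unfolding hausdorff_dim_def
  proof (rule Inf_greatest)
    fix z assume "z \<in> {ereal s |s. 0 \<le> s \<and> hausdorff_measure s A = 0}"
    then obtain s where "z = ereal s" "0 \<le> s" "hausdorff_measure s A = 0" by blast
    then show "1 \<le> z" using assms[of s] by (cases "s < 1") auto
  qed
qed

text \<open>A branch is chosen by a sequence of child numbers below \<open>B\<close>, which is read off from the base-\<open>B\<close>
  expansion of a number in \<open>[0, 1)\<close>. Two numbers whose expansions split at level \<open>k\<close> have distance at
  most \<open>B\<^sup>-\<^sup>k\<close>, and the corresponding points have distance at least \<open>l\<^sup>k\<^sup>+\<^sup>1\<close>. The condition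
  \<open>B l\<^sup>s \<ge> 1\<close> compares the two.\<close>

lemma hausdorff_measure_tree_nonzero:
  fixes Node :: "nat \<Rightarrow> real \<Rightarrow> bool" and B :: nat
  assumes l: "0 < l" "l < 1" and s: "s \<ge> 0" and B: "B \<ge> 2" "real B * l powr s \<ge> 1"
    and root: "Node 0 a0"
    and step: "\<And>k a. Node k a \<Longrightarrow> \<exists>ch::nat \<Rightarrow> real. \<forall>i<B. Node (Suc k) (ch i) \<and> a \<le> ch i \<and>
       ch i + l ^ Suc k \<le> a + l ^ k \<and> (\<forall>j<B. i \<noteq> j \<longrightarrow> \<bar>ch i - ch j\<bar> \<ge> 2 * l ^ Suc k)"
    and A: "\<And>y. (\<And>k. \<exists>a. Node k a \<and> a \<le> y \<and> y \<le> a + l ^ k) \<Longrightarrow> y \<in> A"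
  shows "hausdorff_measure s A \<noteq> 0"
proof -
  obtain ch :: "nat \<Rightarrow> real \<Rightarrow> nat \<Rightarrow> real" where
    ch: "\<And>k a i. Node k a \<Longrightarrow> i < B \<Longrightarrow> Node (Suc k) (ch k a i) \<and> a \<le> ch k a i \<and>
       ch k a i + l ^ Suc k \<le> a + l ^ k" and
    sep: "\<And>k a i j. Node k a \<Longrightarrow> i < B \<Longrightarrow> j < B \<Longrightarrow> i \<noteq> j \<Longrightarrow> \<bar>ch k a i - ch k a j\<bar> \<ge> 2 * l ^ Suc k"
    using step by metis
  define dig where "dig x k = beta_digits (real B) x k" for x k
  have dig: "dig x k < B" if "x \<in> {0..<1}" for x k
  proof -
    have "(beta_map (real B) ^^ k) x \<in> {0..<1}" using beta_iterate_range[OF that] .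
    then have "real B * (beta_map (real B) ^^ k) x < real B * 1"
      using B(1) by (intro mult_strict_left_mono) auto
    then have "\<lfloor>real B * (beta_map (real B) ^^ k) x\<rfloor> < int B" by (simp add: floor_less_iff)
    then show ?thesis using B(1) unfolding dig_def beta_digits_def by linarith
  qed
  define pos where "pos x = rec_nat a0 (\<lambda>k a. ch k a (dig x k))" for x
  have pos0: "pos x 0 = a0" and posS: "pos x (Suc k) = ch k (pos x k) (dig x k)" for x k
    unfolding pos_def by simp_all
  have node: "Node k (pos x k)" if "x \<in> {0..<1}" for x k
    by (induction k) (use root ch dig[OF that] in \<open>auto simp: pos0 posS\<close>)
  have inc: "incseq (pos x)" if "x \<in> {0..<1}" for x
    by (rule incseq_SucI) (use ch[OF node[OF that] dig[OF that]] in \<open>auto simp: posS\<close>)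
  have dec: "decseq (\<lambda>k. pos x k + l ^ k)" if "x \<in> {0..<1}" for x
    by (rule decseq_SucI) (use ch[OF node[OF that] dig[OF that]] in \<open>auto simp: posS\<close>)
  have cross: "pos x j \<le> pos x k + l ^ k" if x: "x \<in> {0..<1}" for x j k
  proof -
    have "pos x j \<le> pos x (max j k)" using incseqD[OF inc[OF x]] by simp
    also have "\<dots> \<le> pos x (max j k) + l ^ max j k" using l by simp
    also have "\<dots> \<le> pos x k + l ^ k" using decseqD[OF dec[OF x], of k "max j k"] by simp
    finally show ?thesis .
  qed
  define g where "g x = (SUP k. pos x k)" for x
  have g: "pos x k \<le> g x" "g x \<le> pos x k + l ^ k" if x: "x \<in> {0..<1}" for x k
  proof -
    have "bdd_above (range (pos x))" using cross[OF x, of _ 0] by (intro bdd_aboveI2) auto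
    then show "pos x k \<le> g x" unfolding g_def by (intro cSUP_upper) auto
    show "g x \<le> pos x k + l ^ k" unfolding g_def using cross[OF x] by (intro cSUP_least) auto
  qed
  \<comment> \<open>each level loses a factor \<open>1 / B\<close> on the side of the codes and \<open>l\<^sup>s\<close> on the other side\<close>
  have lB: "1 / real B \<le> l powr s" using B by (simp add: field_simps)
  have holder: "g x \<noteq> g x' \<and> \<bar>x - x'\<bar> \<le> (1 / l powr s) * dist (g x) (g x') powr s"
    if x: "x \<in> {0..<1}" "x' \<in> {0..<1}" "x \<noteq> x'" for x x'
  proof -
    have "\<exists>k. dig x k \<noteq> dig x' k"
    proof (rule ccontr)
      assume "\<not> ?thesis"
      then have "\<bar>x - x'\<bar> \<le> 1 / real B ^ k" for k
        using digits_eq_imp_close[of "real B" x x' k] x B(1) unfolding dig_def by simp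
      moreover obtain k where "(1 / real B) ^ k < \<bar>x - x'\<bar>"
        using real_arch_pow_inv[of "\<bar>x - x'\<bar>" "1 / real B"] x(3) B(1) by auto
      ultimately show False by (metis not_less power_one_over)
    qed
    define k where "k = (LEAST k. dig x k \<noteq> dig x' k)"
    have k: "dig x k \<noteq> dig x' k" using LeastI_ex[OF \<open>\<exists>k. dig x k \<noteq> dig x' k\<close>] unfolding k_def .
    have eq: "dig x i = dig x' i" if "i < k" for i
      using not_less_Least[of i "\<lambda>k. dig x k \<noteq> dig x' k"] that unfolding k_def by blast
    have poseq: "pos x i = pos x' i" if "i \<le> k" for i
      using that by (induction i) (use eq in \<open>auto simp: pos0 posS\<close>)
    have "\<bar>pos x (Suc k) - pos x' (Suc k)\<bar> \<ge> 2 * l ^ Suc k"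
      unfolding posS poseq[OF order_refl, symmetric]
      by (rule sep[OF node[OF x(1)] dig[OF x(1)] dig[OF x(2)] k])
    then have far: "dist (g x) (g x') \<ge> l ^ Suc k"
      using g[OF x(1), of "Suc k"] g[OF x(2), of "Suc k"] unfolding dist_real_def by linarith
    have "\<bar>x - x'\<bar> \<le> 1 / real B ^ k"
      using digits_eq_imp_close[of "real B" x x' k] x B(1) eq unfolding dig_def by simp
    also have "\<dots> = (1 / real B) ^ k" by (simp add: power_one_over)
    also have "\<dots> \<le> (l powr s) ^ k" using lB by (intro power_mono) auto
    also have "\<dots> = (1 / l powr s) * (l ^ Suc k) powr s"
      using l by (simp add: powr_mult powr_power powr_realpow[symmetric] powr_powr mult.commute)
    also have "\<dots> \<le> (1 / l powr s) * dist (g x) (g x') powr s"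
      using far l s by (intro mult_left_mono powr_mono2) auto
    finally show ?thesis using far zero_less_power[OF l(1), of "Suc k"] by auto
  qed
  show ?thesis
  proof (rule hausdorff_measure_nonzero[OF s _ holder])
    show "g ` {0..<1} \<subseteq> A" using A g node by blast
  qed (use l in auto)
qed

section \<open>Cutting an interval simultaneously for several maps\<close>

text \<open>Every piece that is cut contains a zero of \<open>f\<^sup>m\<^sup>+\<^sup>g\<close>. As \<open>f\<^sup>m\<close> is injective on the whole
  interval, it maps these zeros to distinct zeros of \<open>f\<^sup>g\<close> in the image. Counting in the image keeps
  the error term linear in \<open>g\<close> instead of \<open>m + g\<close>.\<close>

lemma card_cut_pieces:
  assumes \<beta>: "\<beta> > 1" and a: "0 \<le> a" "p > 0" "a + real M * p \<le> 1" and M: "M > 0"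
    and un: "uncut \<beta> m a (a + real M * p)"
  shows "real (card {i\<in>{..<M}. \<not> uncut \<beta> (m + g) (a + real i * p) (a + real (Suc i) * p)})
    \<le> \<beta> ^ m * (real M * p) * geom_sum \<beta> g + real g + 1"
proof -
  let ?bad = "{i\<in>{..<M}. \<not> uncut \<beta> (m + g) (a + real i * p) (a + real (Suc i) * p)}"
  let ?u = "(beta_map \<beta> ^^ m) a" and ?b = "a + real M * p"
  have Mp: "real M * p > 0" using M a by simp
  have "\<forall>i. \<exists>x. i \<in> ?bad \<longrightarrow> x \<in> {a + real i * p<..<a + real (Suc i) * p} \<and> (beta_map \<beta> ^^ (m + g)) x = 0"
    unfolding uncut_def by blast
  from choice[OF this] obtain x where x: "\<And>i. i \<in> ?bad \<Longrightarrow>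
      x i \<in> {a + real i * p<..<a + real (Suc i) * p} \<and> (beta_map \<beta> ^^ (m + g)) (x i) = 0"
    by blast
  have mono: "x i < x j" if "i \<in> ?bad" "j \<in> ?bad" "i < j" for i j
  proof -
    have "real (Suc i) * p \<le> real j * p" using that a by (intro mult_right_mono) auto
    then show ?thesis using x[OF that(1)] x[OF that(2)] by auto
  qed
  have xab: "x i \<in> {a..<?b}" if "i \<in> ?bad" for i
  proof -
    have "real (Suc i) * p \<le> real M * p" "0 \<le> real i * p" using that a by (auto intro: mult_right_mono)
    then show ?thesis using x[OF that] by auto
  qed
  have fx: "(beta_map \<beta> ^^ m) (x i) = ?u + \<beta> ^ m * (x i - a)" if "i \<in> ?bad" for i
    by (rule uncut_imp_affine(1)[OF _ un xab[OF that]]) (use \<beta> in simp)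
  have short: "?u + \<beta> ^ m * (real M * p) \<le> 1" "0 \<le> ?u"
    using uncut_imp_short[OF _ un] beta_iterate_range[of a m \<beta>] \<beta> a Mp by auto
  let ?v = "?u + \<beta> ^ m * (real M * p)"
  have "inj_on (\<lambda>i. (beta_map \<beta> ^^ m) (x i)) ?bad"
  proof (rule linorder_inj_onI')
    fix i j assume "i \<in> ?bad" "j \<in> ?bad" "i < j"
    then show "(beta_map \<beta> ^^ m) (x i) \<noteq> (beta_map \<beta> ^^ m) (x j)"
      using mono[of i j] fx[of i] fx[of j] \<beta> by auto
  qed
  moreover have "(\<lambda>i. (beta_map \<beta> ^^ m) (x i)) ` ?bad \<subseteq> cut_points \<beta> g ?u ?v"
  proof (rule image_subsetI)
    fix i assume i: "i \<in> ?bad"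
    have "\<beta> ^ m * (x i - a) < \<beta> ^ m * (real M * p)" "0 \<le> \<beta> ^ m * (x i - a)"
      using xab[OF i] \<beta> by auto
    moreover have "(beta_map \<beta> ^^ g) ((beta_map \<beta> ^^ m) (x i)) = 0"
      using x[OF i] by (simp flip: beta_iterate_add)
    ultimately show "(beta_map \<beta> ^^ m) (x i) \<in> cut_points \<beta> g ?u ?v"
      unfolding cut_points_def using fx[OF i] by simp
  qed
  ultimately have "card ?bad \<le> card (cut_points \<beta> g ?u ?v)"
    by (rule card_inj_on_le) (rule finite_cut_points[OF \<beta> short(2,1)])
  also have "real \<dots> \<le> (?v - ?u) * geom_sum \<beta> g + real g + 1"
    using card_cut_points_le[OF \<beta> short(2) _ short(1), of g] Mp \<beta> by simp
  finally show ?thesis by simp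
qed

lemma exists_scale:
  fixes \<beta> X \<epsilon> :: real
  assumes "\<beta> > 1" "0 < X" "X \<le> \<epsilon>"
  obtains g where "\<beta> ^ g * X \<le> \<epsilon>" "\<epsilon> < \<beta> ^ Suc g * X"
proof -
  let ?P = "\<lambda>g. \<epsilon> < \<beta> ^ g * X"
  obtain n where "\<epsilon> / X < \<beta> ^ n" using real_arch_pow[OF assms(1)] by blast
  then have ex: "?P n" using assms by (simp add: field_simps)
  define g where "g = (LEAST g. ?P g)"
  have g: "?P g" using LeastI[of ?P, OF ex] unfolding g_def .
  then have "g \<noteq> 0" using assms by (metis mult_1 not_less power_0)
  then obtain g' where g': "g = Suc g'" using not0_implies_Suc by blast
  then have "\<not> ?P g'" using not_less_Least[of g' ?P] unfolding g_def by simp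
  then show thesis using g g' that[of g'] by simp
qed

text \<open>The order \<open>m'\<close> is chosen such that \<open>f\<^sup>m\<^sup>'\<close> stretches the pieces to a length between
  \<open>\<epsilon> / \<beta>\<close> and \<open>\<epsilon>\<close>. Then the main term of the count is a small multiple \<open>\<theta>\<close> of \<open>M\<close>, while
  the linear term is logarithmic in \<open>M\<close>, as expressed by \<open>growth\<close>.\<close>

lemma few_cut_pieces:
  assumes \<beta>: "\<beta> > 1" and a: "0 \<le> a" "p > 0" "a + real M * p \<le> 1" and M: "M > 0"
    and un: "uncut \<beta> m a (a + real M * p)" and \<kappa>: "\<kappa> > 0" "\<beta> ^ m * (real M * p) \<ge> \<kappa>"
    and \<epsilon>: "1 / real M \<le> \<epsilon>" "\<beta> / (\<beta> - 1) * \<epsilon> \<le> \<theta>"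
    and growth: "\<And>g. \<beta> ^ g \<le> \<epsilon> / \<kappa> * real M \<Longrightarrow> real g + 1 \<le> \<theta> * real M"
  shows "\<exists>m'. \<beta> ^ m' * p \<ge> \<epsilon> / \<beta> \<and>
    real (card {i\<in>{..<M}. \<not> uncut \<beta> m' (a + real i * p) (a + real (Suc i) * p)}) \<le> 2 * \<theta> * real M"
proof -
  let ?u = "(beta_map \<beta> ^^ m) a"
  have Mp: "real M * p > 0" using M a by simp
  have "\<beta> ^ m * (real M * p) \<le> 1"
    using uncut_imp_short[OF _ un] beta_iterate_range[of a m \<beta>] \<beta> a Mp by auto
  then have "\<beta> ^ m * p * real M \<le> 1" by (simp add: algebra_simps)
  then have "\<beta> ^ m * p \<le> 1 / real M" using M by (simp add: field_simps)
  then have "0 < \<beta> ^ m * p" "\<beta> ^ m * p \<le> \<epsilon>" using \<epsilon> a \<beta> by auto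
  then obtain g where g: "\<beta> ^ g * (\<beta> ^ m * p) \<le> \<epsilon>" "\<epsilon> < \<beta> ^ Suc g * (\<beta> ^ m * p)"
    using exists_scale[OF \<beta>] by metis
  have "\<beta> ^ g * \<kappa> \<le> \<beta> ^ g * (\<beta> ^ m * (real M * p))" using \<kappa> \<beta> by (intro mult_left_mono) auto
  also have "\<dots> = \<beta> ^ g * (\<beta> ^ m * p) * real M" by simp
  also have "\<dots> \<le> \<epsilon> * real M" using g by (intro mult_right_mono) auto
  finally have "\<beta> ^ g \<le> \<epsilon> / \<kappa> * real M" using \<kappa> by (simp add: field_simps)
  note gM = growth[OF this]
  have "real (card {i\<in>{..<M}. \<not> uncut \<beta> (m + g) (a + real i * p) (a + real (Suc i) * p)})
      \<le> \<beta> ^ m * (real M * p) * geom_sum \<beta> g + (real g + 1)"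
    using card_cut_pieces[OF \<beta> a M un, of g] by simp
  also have "\<beta> ^ m * (real M * p) * geom_sum \<beta> g \<le> \<beta> ^ m * (real M * p) * (\<beta> / (\<beta> - 1) * \<beta> ^ g)"
    using geom_sum_le[OF \<beta>, of g] Mp \<beta> by (intro mult_left_mono) auto
  also have "\<dots> = \<beta> / (\<beta> - 1) * (\<beta> ^ g * (\<beta> ^ m * p)) * real M" by simp
  also have "\<dots> \<le> \<beta> / (\<beta> - 1) * \<epsilon> * real M"
    using g \<beta> by (intro mult_right_mono mult_left_mono) auto
  also have "\<dots> \<le> \<theta> * real M" using \<epsilon> by (intro mult_right_mono) auto
  finally have "real (card {i\<in>{..<M}. \<not> uncut \<beta> (m + g) (a + real i * p) (a + real (Suc i) * p)})
      \<le> 2 * \<theta> * real M" using gM by simp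
  moreover have "\<beta> ^ (m + g) * p \<ge> \<epsilon> / \<beta>"
    using g(2) \<beta> by (simp add: power_add field_simps)
  ultimately show ?thesis by blast
qed

text \<open>The value of \<open>\<theta>\<close> makes the cut pieces of all maps together at most half of all pieces.
  The function \<open>e\<close> enumerates good ones.\<close>

lemma many_good_pieces:
  fixes \<beta> \<epsilon> \<kappa> :: "'i \<Rightarrow> real" and S :: "'i set" and M :: nat and \<theta> :: real
  assumes \<theta>: "\<theta> = 1 / (4 * (real (card S) + 1))" and S: "finite S" and \<beta>: "\<And>n. n \<in> S \<Longrightarrow> \<beta> n > 1" and a: "0 \<le> a" "p > 0" "a + real M * p \<le> 1" and M: "M > 0"
    and un: "\<And>n. n \<in> S \<Longrightarrow> \<exists>m. uncut (\<beta> n) m a (a + real M * p) \<and> \<beta> n ^ m * (real M * p) \<ge> \<kappa> n"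
    and \<kappa>: "\<And>n. n \<in> S \<Longrightarrow> \<kappa> n > 0"
    and \<epsilon>: "\<And>n. n \<in> S \<Longrightarrow> 1 / real M \<le> \<epsilon> n" "\<And>n. n \<in> S \<Longrightarrow> \<beta> n / (\<beta> n - 1) * \<epsilon> n \<le> \<theta>"
    and growth: "\<And>n g. n \<in> S \<Longrightarrow> \<beta> n ^ g \<le> \<epsilon> n / \<kappa> n * real M \<Longrightarrow> real g + 1 \<le> \<theta> * real M"
  shows "\<exists>m' e. inj_on e {..<M div 2} \<and> (\<forall>j<M div 2. e j < M \<and> (\<forall>n\<in>S.
    uncut (\<beta> n) (m' n) (a + real (e j) * p) (a + real (Suc (e j)) * p) \<and> \<beta> n ^ m' n * p \<ge> \<epsilon> n / \<beta> n))"
proof -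
  let ?bad = "\<lambda>m' n. {i\<in>{..<M}. \<not> uncut (\<beta> n) (m' n) (a + real i * p) (a + real (Suc i) * p)}"
  have "\<exists>m'. \<beta> n ^ m' * p \<ge> \<epsilon> n / \<beta> n \<and>
    real (card {i\<in>{..<M}. \<not> uncut (\<beta> n) m' (a + real i * p) (a + real (Suc i) * p)}) \<le> 2 * \<theta> * real M"
    if n: "n \<in> S" for n
  proof -
    obtain m where "uncut (\<beta> n) m a (a + real M * p)" "\<beta> n ^ m * (real M * p) \<ge> \<kappa> n"
      using un[OF n] by blast
    then show ?thesis
      using few_cut_pieces[OF \<beta>[OF n] a M _ \<kappa>[OF n] _ \<epsilon>[OF n] growth[OF n], of m] by blast
  qed
  then have "\<forall>n. \<exists>m'. n \<in> S \<longrightarrow> \<beta> n ^ m' * p \<ge> \<epsilon> n / \<beta> n \<and>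
    real (card {i\<in>{..<M}. \<not> uncut (\<beta> n) m' (a + real i * p) (a + real (Suc i) * p)}) \<le> 2 * \<theta> * real M"
    by blast
  from choice[OF this] obtain m' where m': "\<And>n. n \<in> S \<Longrightarrow> \<beta> n ^ m' n * p \<ge> \<epsilon> n / \<beta> n"
    "\<And>n. n \<in> S \<Longrightarrow> real (card (?bad m' n)) \<le> 2 * \<theta> * real M" by blast
  let ?Bad = "\<Union>n\<in>S. ?bad m' n"
  have "card ?Bad \<le> (\<Sum>n\<in>S. card (?bad m' n))" by (rule card_UN_le[OF S])
  then have "real (card ?Bad) \<le> real (\<Sum>n\<in>S. card (?bad m' n))" by (rule of_nat_mono)
  also have "\<dots> = (\<Sum>n\<in>S. real (card (?bad m' n)))" by simp
  also have "\<dots> \<le> real (card S) * (2 * \<theta> * real M)" by (rule sum_bounded_above) (rule m'(2))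
  also have "\<dots> \<le> real M / 2"
  proof -
    have "real (card S) * (2 * \<theta>) \<le> 1 / 2" unfolding \<theta> by (simp add: field_simps)
    then have "real (card S) * (2 * \<theta>) * real M \<le> 1 / 2 * real M" by (intro mult_right_mono) auto
    then show ?thesis by (simp add: mult.assoc)
  qed
  finally have bad: "2 * card ?Bad \<le> M" by linarith
  let ?Good = "{..<M} - ?Bad"
  have "card ?Good = M - card ?Bad"
    by (subst card_Diff_subset) (use S in auto)
  then have "M div 2 \<le> card ?Good" using bad by linarith
  then obtain e where e: "e ` {..<M div 2} \<subseteq> ?Good" "inj_on e {..<M div 2}"
    using card_le_inj[of "{..<M div 2}" ?Good] by auto
  have good: "uncut (\<beta> n) (m' n) (a + real (e j) * p) (a + real (Suc (e j)) * p)" "e j < M"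
    if "j < M div 2" "n \<in> S" for j n
  proof -
    have "e j \<in> ?Good" using e(1) that(1) by blast
    then show "uncut (\<beta> n) (m' n) (a + real (e j) * p) (a + real (Suc (e j)) * p)" "e j < M"
      using that(2) by blast+
  qed
  have "e j < M" if "j < M div 2" for j using e(1) that by blast
  then show ?thesis using e(2) m'(1) good(1)
    by (intro exI[of _ m'] exI[of _ e] conjI allI impI ballI) auto
qed

text \<open>The number of iterations available in one step of the tree grows only logarithmically with \<open>M\<close>.\<close>

lemma eventually_growth:
  fixes b K \<theta> :: real
  assumes "b > 1" "K > 0" "\<theta> > 0"
  shows "eventually (\<lambda>M::nat. \<forall>g. b ^ g \<le> K * real M \<longrightarrow> real g + 1 \<le> \<theta> * real M) sequentially"
proof -
  define L where "L = ln b"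
  have L: "L > 0" using assms unfolding L_def by simp
  have "eventually (\<lambda>M::nat. ln (K * real M) / L + 1 \<le> \<theta> * real M) sequentially"
    using L assms by real_asymp
  then show ?thesis
  proof eventually_elim
    case (elim M)
    show ?case
    proof (intro allI impI)
      fix g assume g: "b ^ g \<le> K * real M"
      have "0 < b ^ g" using assms by simp
      then have "ln (b ^ g) \<le> ln (K * real M)" using g by (intro ln_mono) auto
      then have "real g * L \<le> ln (K * real M)" using assms unfolding L_def by (simp add: ln_realpow)
      then have "real g \<le> ln (K * real M) / L" using L by (simp add: field_simps)
      then show "real g + 1 \<le> \<theta> * real M" using elim by simp
    qed
  qed
qed

text \<open>The numerical heart of the dimension estimate: with about \<open>M / 2\<close> children of relative length
  \<open>c / M\<close>, the exponent \<open>s\<close> is exceeded for large \<open>M\<close>.\<close>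

lemma eventually_branching:
  fixes c s :: real
  assumes "0 < c" "s < 1"
  shows "eventually (\<lambda>M::nat. real (M div 2) * (c / real M) powr s \<ge> 1) sequentially"
proof -
  have "eventually (\<lambda>M::nat. (real M / 2 - 1) * (c / real M) powr s \<ge> 1) sequentially"
    using assms by real_asymp
  then show ?thesis
  proof eventually_elim
    case (elim M)
    have "real M / 2 - 1 \<le> real (M div 2)" by linarith
    then have "(real M / 2 - 1) * (c / real M) powr s \<le> real (M div 2) * (c / real M) powr s"
      by (rule mult_right_mono) simp
    then show ?case using elim by simp
  qed
qed

text \<open>The constants are fixed in the order \<open>\<theta>\<close>, \<open>\<epsilon>\<close>, \<open>\<eta>\<close>, \<open>c\<close>, \<open>\<kappa>\<close>, \<open>M\<close>: each depends
  on the earlier ones only, and \<open>M\<close> is the last one to be chosen. The invariant \<open>good\<close> of the tree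
  provides at once the robust occurrences of the words around the points of a node and the affine
  iterate with image of length at least \<open>\<kappa>\<close> that is needed for the next subdivision. The set \<open>A\<close>
  enters only through the fact that it contains every point around which the words recur robustly at
  the scales \<open>l\<^sup>k\<^sup>+\<^sup>1\<close>.\<close>

lemma hausdorff_measure_recurrent_words:
  fixes \<beta> :: "'i \<Rightarrow> real" and S :: "'i set" and w :: "'i \<Rightarrow> nat list"
  assumes S: "finite S" and \<beta>: "\<And>n. n \<in> S \<Longrightarrow> \<beta> n > 1"
    and w: "\<And>n. n \<in> S \<Longrightarrow> admissible (\<beta> n) (w n)" and s: "0 \<le> s" "s < 1"
    and A: "\<And>y l D. 0 < l \<Longrightarrow> l < 1 \<Longrightarrow> (\<And>n. n \<in> S \<Longrightarrow> D n > 0) \<Longrightarrow>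
      (\<And>n k. n \<in> S \<Longrightarrow> \<exists>t. word_at (\<beta> n) (w n) t (y - l * l ^ k) (y + l * l ^ k) \<and>
         0 \<le> y - l * l ^ k \<and> y + l * l ^ k \<le> 1 \<and> \<beta> n ^ t * (l * l ^ k) \<ge> D n) \<Longrightarrow> y \<in> A"
  shows "hausdorff_measure s A \<noteq> 0"
proof -
  define \<theta> where "\<theta> = 1 / (4 * (real (card S) + 1))"
  have \<theta>: "\<theta> > 0" "\<theta> \<le> 1" unfolding \<theta>_def by (auto simp: field_simps)
  define \<epsilon> where "\<epsilon> n = \<theta> * (\<beta> n - 1) / \<beta> n" for n
  have \<epsilon>: "\<epsilon> n > 0" "\<beta> n / (\<beta> n - 1) * \<epsilon> n \<le> \<theta>" "\<epsilon> n \<le> 1" if "n \<in> S" for n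
  proof -
    show "\<epsilon> n > 0" "\<beta> n / (\<beta> n - 1) * \<epsilon> n \<le> \<theta>"
      using \<theta> \<beta>[OF that] unfolding \<epsilon>_def by auto
    have "\<theta> * (\<beta> n - 1) \<le> 1 * \<beta> n" using \<theta> \<beta>[OF that] by (intro mult_mono) auto
    then show "\<epsilon> n \<le> 1" using \<beta>[OF that] unfolding \<epsilon>_def by (simp add: divide_le_eq)
  qed
  define \<eta> where "\<eta> n = \<epsilon> n / \<beta> n" for n
  have \<eta>: "\<eta> n > 0" "\<eta> n \<le> 1" if "n \<in> S" for n
    using \<epsilon>[OF that] \<beta>[OF that] unfolding \<eta>_def by (auto simp: divide_le_eq)
  have "\<exists>c>0. c \<le> 1 \<and> (\<forall>a b m. 0 \<le> a \<longrightarrow> a < b \<longrightarrow> b \<le> 1 \<longrightarrow>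
      (\<forall>n\<in>S. uncut (\<beta> n) (m n) a b \<and> \<beta> n ^ m n * (b - a) \<ge> \<eta> n) \<longrightarrow>
      (\<exists>a' b'. a \<le> a' \<and> a' + c * (b - a) \<le> b' \<and> b' \<le> b \<and>
         (\<forall>n\<in>S. \<exists>t\<ge>m n. word_at (\<beta> n) (w n) t a' b')))"
    by (rule word_at_simultaneous[OF S]) (use \<beta> w \<eta>(1) in auto)
  then obtain c where c: "c > 0" "c \<le> 1" and cw: "\<forall>a b m. 0 \<le> a \<longrightarrow> a < b \<longrightarrow> b \<le> 1 \<longrightarrow>
      (\<forall>n\<in>S. uncut (\<beta> n) (m n) a b \<and> \<beta> n ^ m n * (b - a) \<ge> \<eta> n) \<longrightarrow>
      (\<exists>a' b'. a \<le> a' \<and> a' + c * (b - a) \<le> b' \<and> b' \<le> b \<and>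
         (\<forall>n\<in>S. \<exists>t\<ge>m n. word_at (\<beta> n) (w n) t a' b'))" by (elim exE conjE)
  define \<kappa> where "\<kappa> n = \<eta> n * (c / 3)" for n
  have \<kappa>: "\<kappa> n > 0" "\<kappa> n \<le> 1" if "n \<in> S" for n
  proof -
    show "\<kappa> n > 0" using \<eta>(1)[OF that] c unfolding \<kappa>_def by simp
    show "\<kappa> n \<le> 1" unfolding \<kappa>_def
      by (rule mult_le_one) (use \<eta>(2)[OF that] c in auto)
  qed
  have ev: "eventually (\<lambda>M::nat. \<forall>n\<in>S. 1 / real M \<le> \<epsilon> n \<and>
      (\<forall>g. \<beta> n ^ g \<le> \<epsilon> n / \<kappa> n * real M \<longrightarrow> real g + 1 \<le> \<theta> * real M)) sequentially"
  proof (rule eventually_ball_finite[OF S], rule ballI, rule eventually_conj)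
    fix n assume n: "n \<in> S"
    show "eventually (\<lambda>M::nat. 1 / real M \<le> \<epsilon> n) sequentially"
      using \<epsilon>(1)[OF n] by real_asymp
    show "eventually (\<lambda>M::nat. \<forall>g. \<beta> n ^ g \<le> \<epsilon> n / \<kappa> n * real M \<longrightarrow> real g + 1 \<le> \<theta> * real M) sequentially"
      by (rule eventually_growth) (use \<beta> \<epsilon> \<kappa> \<theta> n in auto)
  qed
  have "eventually (\<lambda>M::nat. M \<ge> 4 \<and> (\<forall>n\<in>S. 1 / real M \<le> \<epsilon> n \<and>
      (\<forall>g. \<beta> n ^ g \<le> \<epsilon> n / \<kappa> n * real M \<longrightarrow> real g + 1 \<le> \<theta> * real M)) \<and>
      real (M div 2) * (c / 3 / real M) powr s \<ge> 1) sequentially"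
    by (intro eventually_conj eventually_ge_at_top ev eventually_branching) (use c s in auto)
  then obtain M :: nat where M: "M \<ge> 4" "\<And>n. n \<in> S \<Longrightarrow> 1 / real M \<le> \<epsilon> n"
      "\<And>n g. n \<in> S \<Longrightarrow> \<beta> n ^ g \<le> \<epsilon> n / \<kappa> n * real M \<Longrightarrow> real g + 1 \<le> \<theta> * real M"
      "real (M div 2) * (c / 3 / real M) powr s \<ge> 1"
    unfolding eventually_sequentially by blast
  define l where "l = c / 3 / real M"
  have l: "0 < l" "l < 1" using c M(1) unfolding l_def by (auto simp: divide_less_eq)
  \<comment> \<open>The node \<open>[a, a + l\<^sup>k]\<close> is the middle third of an interval on which the words occur. Hence
    balls of radius \<open>l\<^sup>k\<close> around its points stay inside that interval, and distinct nodes of a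
    level are far apart.\<close>
  define good where "good k a \<longleftrightarrow> 0 \<le> a - l ^ k \<and> a + 2 * l ^ k \<le> 1 \<and>
      (\<forall>n\<in>S. \<exists>t. word_at (\<beta> n) (w n) t (a - l ^ k) (a + 2 * l ^ k) \<and> \<beta> n ^ t * l ^ k \<ge> \<kappa> n)" for k a
  define Node where "Node k a \<longleftrightarrow> (if k = 0 then a = 0 else good k a)" for k :: nat and a
  have Node: "0 \<le> a \<and> a + l ^ k \<le> 1 \<and> (\<forall>n\<in>S. \<exists>m. uncut (\<beta> n) m a (a + l ^ k) \<and> \<beta> n ^ m * l ^ k \<ge> \<kappa> n)"
    if "Node k a" for k a
  proof (cases k)
    case 0
    have "uncut (\<beta> n) 0 0 1" for n unfolding uncut_def by simp
    then have "\<exists>m. uncut (\<beta> n) m 0 1 \<and> \<beta> n ^ m * 1 \<ge> \<kappa> n" if "n \<in> S" for n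
      using \<kappa>(2)[OF that] by (intro exI[of _ 0]) simp
    then show ?thesis using that 0 unfolding Node_def by simp
  next
    case (Suc k')
    then have g: "good k a" using that unfolding Node_def by simp
    have lk: "l ^ k > 0" using l by simp
    have "\<exists>m. uncut (\<beta> n) m a (a + l ^ k) \<and> \<beta> n ^ m * l ^ k \<ge> \<kappa> n" if "n \<in> S" for n
    proof -
      have "\<exists>t. word_at (\<beta> n) (w n) t (a - l ^ k) (a + 2 * l ^ k) \<and> \<beta> n ^ t * l ^ k \<ge> \<kappa> n"
        using g that unfolding good_def by simp
      then obtain t where t: "word_at (\<beta> n) (w n) t (a - l ^ k) (a + 2 * l ^ k)" "\<beta> n ^ t * l ^ k \<ge> \<kappa> n"
        by (elim exE conjE)
      have "uncut (\<beta> n) (t + length (w n)) (a - l ^ k) (a + 2 * l ^ k)"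
        using t(1) unfolding word_at_def by (elim conjE)
      then have "uncut (\<beta> n) t a (a + l ^ k)" by (rule uncut_mono) (use lk in auto)
      then show ?thesis using t(2) by (intro exI[of _ t] conjI)
    qed
    moreover have "0 \<le> a" "a + l ^ k \<le> 1" using g lk unfolding good_def by linarith+
    ultimately show ?thesis by simp
  qed
  show ?thesis
  proof (rule hausdorff_measure_tree_nonzero[where Node = Node and B = "M div 2", OF l s(1)])
    show "M div 2 \<ge> 2" using M(1) by simp
    show "real (M div 2) * l powr s \<ge> 1" using M(4) unfolding l_def .
    show "Node 0 0" unfolding Node_def by simp
  next
    fix k a assume "Node k a"
    note N = Node[OF this]
    define p where "p = l ^ k / real M"
    have Mp: "real M * p = l ^ k" using M(1) unfolding p_def by simp
    have p: "p > 0" using l M(1) unfolding p_def by simp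
    have l3: "c * p = 3 * l ^ Suc k" unfolding p_def l_def by simp
    have lS: "l ^ Suc k > 0" using l by simp
    have "\<exists>m' e. inj_on e {..<M div 2} \<and> (\<forall>j<M div 2. e j < M \<and> (\<forall>n\<in>S.
      uncut (\<beta> n) (m' n) (a + real (e j) * p) (a + real (Suc (e j)) * p) \<and> \<beta> n ^ m' n * p \<ge> \<epsilon> n / \<beta> n))"
      by (rule many_good_pieces[where \<kappa> = \<kappa>, OF \<theta>_def S \<beta> _ p _ _ _ \<kappa>(1) M(2) \<epsilon>(2) M(3)])
        (use N M(1) in \<open>simp_all add: Mp\<close>)
    then obtain m' e where e: "inj_on e {..<M div 2}" "\<And>j. j < M div 2 \<Longrightarrow> e j < M"
      "\<And>j n. j < M div 2 \<Longrightarrow> n \<in> S \<Longrightarrow>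
         uncut (\<beta> n) (m' n) (a + real (e j) * p) (a + real (Suc (e j)) * p) \<and> \<beta> n ^ m' n * p \<ge> \<eta> n"
      unfolding \<eta>_def by blast
    have "\<exists>x. j < M div 2 \<longrightarrow> a + real (e j) * p + l ^ Suc k \<le> x \<and>
        x + 2 * l ^ Suc k \<le> a + real (Suc (e j)) * p \<and> good (Suc k) x" for j
    proof (cases "j < M div 2")
      case True
      let ?a = "a + real (e j) * p" and ?b = "a + real (Suc (e j)) * p"
      have ba: "?b - ?a = p" by (simp add: algebra_simps)
      have a0: "0 \<le> ?a" "?a < ?b" using N p ba by auto
      have "real (Suc (e j)) * p \<le> real M * p" using e(2)[OF True] p by (intro mult_right_mono) auto
      then have b1: "?b \<le> 1" using N Mp by linarith
      have "\<exists>a' b'. ?a \<le> a' \<and> a' + c * (?b - ?a) \<le> b' \<and> b' \<le> ?b \<and>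
         (\<forall>n\<in>S. \<exists>t\<ge>m' n. word_at (\<beta> n) (w n) t a' b')"
        using cw[THEN spec, THEN spec, THEN spec, of ?a ?b m'] a0 b1 e(3)[OF True] unfolding ba by blast
      then obtain a' b' where ab: "?a \<le> a'" "a' + 3 * l ^ Suc k \<le> b'" "b' \<le> ?b"
        and wt: "\<And>n. n \<in> S \<Longrightarrow> \<exists>t\<ge>m' n. word_at (\<beta> n) (w n) t a' b'" unfolding ba l3 by blast
      have "good (Suc k) (a' + l ^ Suc k)" unfolding good_def
      proof (intro conjI ballI)
        show "0 \<le> a' + l ^ Suc k - l ^ Suc k" using ab a0 by simp
        show "a' + l ^ Suc k + 2 * l ^ Suc k \<le> 1" using ab b1 by simp
        fix n assume n: "n \<in> S"
        obtain t where t: "t \<ge> m' n" "word_at (\<beta> n) (w n) t a' b'" using wt[OF n] by blast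
        have "word_at (\<beta> n) (w n) t (a' + l ^ Suc k - l ^ Suc k) (a' + l ^ Suc k + 2 * l ^ Suc k)"
          by (rule word_at_mono[OF _ t(2)]) (use ab lS \<beta>[OF n] in auto)
        moreover have "\<kappa> n \<le> \<beta> n ^ t * l ^ Suc k"
        proof -
          have "\<kappa> n \<le> \<beta> n ^ m' n * p * (c / 3)"
            unfolding \<kappa>_def using e(3)[OF True n] c by (intro mult_right_mono) auto
          also have "\<dots> = \<beta> n ^ m' n * l ^ Suc k" using l3 by (simp add: field_simps)
          also have "\<dots> \<le> \<beta> n ^ t * l ^ Suc k"
            using t(1) \<beta>[OF n] lS by (intro mult_right_mono power_increasing) auto
          finally show ?thesis .
        qed
        ultimately show "\<exists>t. word_at (\<beta> n) (w n) t (a' + l ^ Suc k - l ^ Suc k) (a' + l ^ Suc k + 2 * l ^ Suc k)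
            \<and> \<kappa> n \<le> \<beta> n ^ t * l ^ Suc k" by blast
      qed
      then show ?thesis using ab by (intro exI[of _ "a' + l ^ Suc k"]) auto
    qed simp
    then have "\<forall>j. \<exists>x. j < M div 2 \<longrightarrow> a + real (e j) * p + l ^ Suc k \<le> x \<and>
        x + 2 * l ^ Suc k \<le> a + real (Suc (e j)) * p \<and> good (Suc k) x" by blast
    from choice[OF this] obtain ch where ch: "\<And>j. j < M div 2 \<Longrightarrow> a + real (e j) * p + l ^ Suc k \<le> ch j \<and>
        ch j + 2 * l ^ Suc k \<le> a + real (Suc (e j)) * p \<and> good (Suc k) (ch j)" by blast
    have sep: "ch i + 2 * l ^ Suc k \<le> ch j" if "i < M div 2" "j < M div 2" "e i < e j" for i j
    proof -
      have "real (Suc (e i)) * p \<le> real (e j) * p" using that p by (intro mult_right_mono) auto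
      then show ?thesis using ch[OF that(1)] ch[OF that(2)] lS by linarith
    qed
    show "\<exists>ch::nat \<Rightarrow> real. \<forall>i<M div 2. Node (Suc k) (ch i) \<and> a \<le> ch i \<and>
       ch i + l ^ Suc k \<le> a + l ^ k \<and> (\<forall>j<M div 2. i \<noteq> j \<longrightarrow> \<bar>ch i - ch j\<bar> \<ge> 2 * l ^ Suc k)"
    proof (intro exI[of _ ch] allI impI conjI)
      fix i assume i: "i < M div 2"
      show "Node (Suc k) (ch i)" using ch[OF i] unfolding Node_def by simp
      have "0 \<le> real (e i) * p" using p by simp
      then show "a \<le> ch i" using ch[OF i] lS by linarith
      have "real (Suc (e i)) * p \<le> real M * p" using e(2)[OF i] p by (intro mult_right_mono) auto
      then show "ch i + l ^ Suc k \<le> a + l ^ k" using ch[OF i] lS unfolding Mp by linarith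
      fix j assume j: "j < M div 2" "i \<noteq> j"
      then have "e i < e j \<or> e j < e i" using e(1) i unfolding inj_on_def by (meson lessThan_iff linorder_neqE_nat)
      then show "\<bar>ch i - ch j\<bar> \<ge> 2 * l ^ Suc k" using sep[of i j] sep[of j i] i j by auto
    qed
  next
    fix y assume y: "\<And>k. \<exists>a. Node k a \<and> a \<le> y \<and> y \<le> a + l ^ k"
    show "y \<in> A"
    proof (rule A[OF l \<kappa>(1)])
      fix n k assume n: "n \<in> S"
      obtain a where a: "Node (Suc k) a" "a \<le> y" "y \<le> a + l ^ Suc k" using y by blast
      have g: "good (Suc k) a" using a(1) unfolding Node_def by simp
      have lS: "l ^ Suc k > 0" using l by simp
      obtain t where t: "word_at (\<beta> n) (w n) t (a - l ^ Suc k) (a + 2 * l ^ Suc k)" "\<beta> n ^ t * l ^ Suc k \<ge> \<kappa> n"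
        using g n unfolding good_def by blast
      have "word_at (\<beta> n) (w n) t (y - l ^ Suc k) (y + l ^ Suc k)"
        by (rule word_at_mono[OF _ t(1)]) (use a lS \<beta>[OF n] in auto)
      moreover have "0 \<le> y - l ^ Suc k" "y + l ^ Suc k \<le> 1" using g a unfolding good_def by linarith+
      ultimately show "\<exists>t. word_at (\<beta> n) (w n) t (y - l * l ^ k) (y + l * l ^ k) \<and>
         0 \<le> y - l * l ^ k \<and> y + l * l ^ k \<le> 1 \<and> \<beta> n ^ t * (l * l ^ k) \<ge> \<kappa> n"
        using t(2) by auto
    qed
  qed
qed

theorem corollary1:
  fixes N :: nat
    and \<beta> :: "nat \<Rightarrow> real"
    and \<Sigma> :: "nat \<Rightarrow> (nat \<Rightarrow> nat) set"
  assumes "\<And>n. n \<in> {1..N} \<Longrightarrow> \<beta> n > 1"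
    and "\<And>n. n \<in> {1..N} \<Longrightarrow> subshift_finite_type (\<Sigma> n)"
    and "\<And>n. n \<in> {1..N} \<Longrightarrow> \<Sigma> n \<subseteq> beta_shift (\<beta> n)"
    and "\<And>n. n \<in> {1..N} \<Longrightarrow>
           \<exists>w. word_occurs w (beta_shift (\<beta> n)) \<and> \<not> word_occurs w (\<Sigma> n)"
  shows "hausdorff_dim
           (\<Inter>n\<in>{1..N}. orbit_avoiding (beta_map (\<beta> n)) (beta_proj (\<beta> n) ` \<Sigma> n)) = 1"
proof (rule hausdorff_dim_eq_1)
  fix s :: real assume s: "0 \<le> s" "s < 1"
  obtain w where w: "\<And>n. n \<in> {1..N} \<Longrightarrow> word_occurs (w n) (beta_shift (\<beta> n)) \<and> \<not> word_occurs (w n) (\<Sigma> n)"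
    using assms(4) by metis
  show "hausdorff_measure s
      (\<Inter>n\<in>{1..N}. orbit_avoiding (beta_map (\<beta> n)) (beta_proj (\<beta> n) ` \<Sigma> n)) \<noteq> 0"
  proof (rule hausdorff_measure_recurrent_words[OF _ assms(1) _ s, where w = w])
    show "admissible (\<beta> n) (w n)" if "n \<in> {1..N}" for n
      using w[OF that] by (intro admissible_if_word_occurs) blast
  next
    fix y l :: real and D :: "nat \<Rightarrow> real"
    assume l: "0 < l" "l < 1" and D: "\<And>n. n \<in> {1..N} \<Longrightarrow> D n > 0"
      and rec: "\<And>n k. n \<in> {1..N} \<Longrightarrow> \<exists>t. word_at (\<beta> n) (w n) t (y - l * l ^ k) (y + l * l ^ k) \<and>
         0 \<le> y - l * l ^ k \<and> y + l * l ^ k \<le> 1 \<and> \<beta> n ^ t * (l * l ^ k) \<ge> D n"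
    have "y \<in> orbit_avoiding (beta_map (\<beta> n)) (beta_proj (\<beta> n) ` \<Sigma> n)" if n: "n \<in> {1..N}" for n
      by (rule orbit_avoiding_if_word_recurs[OF assms(1)[OF n] assms(3)[OF n] _ l(1) l D[OF n] rec[OF n]])
        (use w[OF n] in blast)
    then show "y \<in> (\<Inter>n\<in>{1..N}. orbit_avoiding (beta_map (\<beta> n)) (beta_proj (\<beta> n) ` \<Sigma> n))" by blast
  qed auto
qed

end
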